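(* Let $k_1,k_2,k_3\in\mathbb{R}$. For any $a\ne0$, the periodic function $$u_c(t,x)=a\cosh(\xi),\qquad\xi=\xi(x,t)=\frac12-(x-ct)+\lfloor x-ct\rfloor,$$ where $\lfloor\cdot\rfloor$ denotes the floor function and $$c=\left[\frac{k_1}{3}+\cosh^2(1/2)\left(\frac{2k_1}{3}+k_2\right)\right]a^2+\cosh(1/2)\,k_3a,$$ is a global weak periodic peakon solution, in the sense defined in the context, of $$m_t+k_1[(u^2-u_x^2)m]_x+k_2(u^2m_x+3uu_xm)+k_3(um_x+2u_xm)=0,\qquad m=u-u_{xx}.$$
   Context: Let $\mathbb{S}=[0,1)$, with functions on $\mathbb{S}$ regarded as functions of period one in $x$, and let $G(x)=\frac{1}{2\sinh(1/2)}\cosh(x-\frac12)$ for $x\in[0,1)$, extended with period one (so $u=G*m$ inverts $m=u-u_{xx}$ on $\mathbb{S}$); $*$ denotes periodic convolution in $x$ over $\mathbb{S}$. For $u_0\in W^{1,3}(\mathbb{S})$, a function $u\in L^\infty_{loc}([0,T),W^{1,3}(\mathbb{S}))$ is a weak solution of the periodic problem with initial datum $u_0$ (here $u_0=u_c(0,\cdot)$) if $$\begin{aligned}&\int_0^T\!\!\int_{\mathbb{S}}\Big\{u\varphi_t+\tfrac{k_1+k_2}{3}u^3\varphi_x+\tfrac{k_1}{3}u_x^3\varphi+\tfrac{k_3}{2}u^2\varphi_x-G*\big[(\tfrac{k_1}{3}+\tfrac{k_2}{2})u_x^3\big]\varphi\\&\quad+G*\big[(\tfrac{2k_1}{3}+k_2)u^3+(k_1+\tfrac{3k_2}{2})uu_x^2+k_3u^2+\tfrac{k_3}{2}u_x^2\big]\varphi_x\Big\}dx\,dt+\int_{\mathbb{S}}u_0(x)\varphi(0,x)\,dx=0\end{aligned}$$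 for every smooth test function $\varphi\in C_c^\infty([0,T)\times\mathbb{S})$. It is a global weak solution if $T$ can be taken arbitrarily large. *)

theory Defs
  imports "HOL-Analysis.Analysis"
begin

text \<open>
  Functions on the circle \<open>[0,1)\<close> are functions on the real line of period one; integrals over
  the circle are Lebesgue integrals over \<open>{0..<1}\<close>. A space-time function \<open>u\<close> is
  written \<open>u t x\<close>, so \<open>u t\<close> is its time slice.
\<close>

abbreviation circle :: "real measure"
  where "circle \<equiv> lebesgue_on {0..<1}"

definition period_one :: "(real \<Rightarrow> real) \<Rightarrow> bool"
  where "period_one f \<longleftrightarrow> (\<forall>x. f (x + 1) = f x)"

definition green :: "real \<Rightarrow> real"
  where "green x = 1 / (2 * sinh (1/2)) * cosh (frac x - 1/2)"

definition circle_conv :: "(real \<Rightarrow> real) \<Rightarrow> (real \<Rightarrow> real) \<Rightarrow> real \<Rightarrow> real"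
  where "circle_conv f g x = (LINT y|circle. f (x - y) * g y)"


section \<open>The Sobolev space of exponent three on the circle\<close>

definition smooth_periodic :: "(real \<Rightarrow> real) \<Rightarrow> bool"
  where "smooth_periodic \<psi> \<longleftrightarrow>
    period_one \<psi> \<and> (\<forall>n x. (deriv ^^ n) \<psi> differentiable (at x))"

definition has_weak_deriv :: "(real \<Rightarrow> real) \<Rightarrow> (real \<Rightarrow> real) \<Rightarrow> bool"
  where "has_weak_deriv f g \<longleftrightarrow>
    period_one f \<and> period_one g \<and> integrable circle f \<and> integrable circle g \<and>
    (\<forall>\<psi>. smooth_periodic \<psi> \<longrightarrow>
      (LINT x|circle. f x * deriv \<psi> x) = - (LINT x|circle. g x * \<psi> x))"

text \<open>
  The weak derivative is determined only up to null sets, so the choice below picks a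
  representative; it is used only under integrals over the circle.
\<close>

definition weak_deriv :: "(real \<Rightarrow> real) \<Rightarrow> real \<Rightarrow> real"
  where "weak_deriv f = (SOME g. has_weak_deriv f g)"

definition L3 :: "(real \<Rightarrow> real) set"
  where "L3 = {f. f \<in> borel_measurable circle \<and> integrable circle (\<lambda>x. \<bar>f x\<bar> ^ 3)}"

definition W13 :: "(real \<Rightarrow> real) set"
  where "W13 = {f. period_one f \<and> f \<in> L3 \<and> (\<exists>g\<in>L3. has_weak_deriv f g)}"

definition W13_norm :: "(real \<Rightarrow> real) \<Rightarrow> real"
  where "W13_norm f = (LINT x|circle. \<bar>f x\<bar> ^ 3 + \<bar>weak_deriv f x\<bar> ^ 3) powr (1/3)"

text \<open>
  Strong (Bochner) measurability of \<open>u\<close> as a map from \<open>[0,T)\<close> into \<open>W13\<close>, spelled out because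
  \<open>W13\<close> is not a type: \<open>u\<close> is almost everywhere the norm limit of simple functions.
\<close>

definition W13_measurable :: "real \<Rightarrow> (real \<Rightarrow> real \<Rightarrow> real) \<Rightarrow> bool"
  where "W13_measurable T u \<longleftrightarrow>
    (\<exists>s. (\<forall>n. simple_function (lebesgue_on {0..<T}) (s n) \<and> s n ` {0..<T} \<subseteq> W13) \<and>
         (AE t in lebesgue_on {0..<T}.
            (\<lambda>n. W13_norm (\<lambda>x. s n t x - u t x)) \<longlonglongrightarrow> 0))"

definition Linf_loc_W13 :: "real \<Rightarrow> (real \<Rightarrow> real \<Rightarrow> real) set"
  where "Linf_loc_W13 T = {u.
    (AE t in lebesgue_on {0..<T}. u t \<in> W13) \<and> W13_measurable T u \<and>
    (\<forall>K. compact K \<and> K \<subseteq> {0..<T} \<longrightarrow>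
       (\<exists>C. AE t in lebesgue_on K. W13_norm (u t) \<le> C))}"


section \<open>Weak solutions\<close>

text \<open>
  Test functions: period one in \<open>x\<close>, smooth up to the boundary \<open>t = 0\<close>, with compact support in
  \<open>[0,T)\<close> times the circle. Here \<open>D i j\<close> is the derivative of order \<open>i\<close> in \<open>t\<close> and \<open>j\<close> in \<open>x\<close>
  (one-sided in \<open>t\<close> at \<open>0\<close>). As the circle is compact, only the support in \<open>t\<close> is constrained.
  Values of \<open>\<phi> t\<close> for \<open>t\<close> outside \<open>[0,T)\<close> are irrelevant.
\<close>

definition test_function :: "real \<Rightarrow> (real \<Rightarrow> real \<Rightarrow> real) \<Rightarrow> bool"
  where "test_function T \<phi> \<longleftrightarrow>
    (\<forall>t\<in>{0..<T}. period_one (\<phi> t)) \<and>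
    (\<exists>T'<T. \<forall>t\<in>{0..<T}. T' < t \<longrightarrow> (\<forall>x. \<phi> t x = 0)) \<and>
    (\<exists>D :: nat \<Rightarrow> nat \<Rightarrow> real \<Rightarrow> real \<Rightarrow> real.
       (\<forall>t\<in>{0..<T}. \<forall>x. D 0 0 t x = \<phi> t x) \<and>
       (\<forall>i j. continuous_on ({0..<T} \<times> UNIV) (\<lambda>(t, x). D i j t x) \<and>
         (\<forall>t\<in>{0..<T}. \<forall>x.
            ((\<lambda>s. D i j s x) has_real_derivative D (Suc i) j t x) (at t within {0..<T}) \<and>
            (D i j t has_real_derivative D i (Suc j) t x) (at x))))"

text \<open>
  Weak solutions on \<open>[0,T)\<close>, with initial datum \<open>u0\<close>, of
  \<open>m\<^sub>t + k1 [(u\<^sup>2 - u\<^sub>x\<^sup>2) m]\<^sub>x + k2 (u\<^sup>2 m\<^sub>x + 3 u u\<^sub>x m) + k3 (u m\<^sub>x + 2 u\<^sub>x m) = 0\<close>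
  where \<open>m = u - u\<^sub>x\<^sub>x\<close>. The time derivative of \<open>\<phi>\<close> is two-sided, hence meaningful for \<open>0 < t\<close>,
  which suffices under the integral.
\<close>

definition weak_solution ::
    "real \<Rightarrow> real \<Rightarrow> real \<Rightarrow> real \<Rightarrow> (real \<Rightarrow> real) \<Rightarrow> (real \<Rightarrow> real \<Rightarrow> real) \<Rightarrow> bool"
  where "weak_solution k1 k2 k3 T u0 u \<longleftrightarrow>
    u0 \<in> W13 \<and> u \<in> Linf_loc_W13 T \<and>
    (\<forall>\<phi>. test_function T \<phi> \<longrightarrow>
      (LINT t|lebesgue_on {0..<T}. LINT x|circle.
         (let ux = weak_deriv (u t);
              \<phi>t = deriv (\<lambda>s. \<phi> s x) t;
              \<phi>x = deriv (\<phi> t) x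
          in u t x * \<phi>t
             + (k1 + k2) / 3 * u t x ^ 3 * \<phi>x
             + k1 / 3 * ux x ^ 3 * \<phi> t x
             + k3 / 2 * u t x ^ 2 * \<phi>x
             - circle_conv green (\<lambda>y. (k1 / 3 + k2 / 2) * ux y ^ 3) x * \<phi> t x
             + circle_conv green
                 (\<lambda>y. (2 * k1 / 3 + k2) * u t y ^ 3 + (k1 + 3 * k2 / 2) * u t y * ux y ^ 2
                      + k3 * u t y ^ 2 + k3 / 2 * ux y ^ 2) x * \<phi>x))
      + (LINT x|circle. u0 x * \<phi> 0 x) = 0)"

definition global_weak_solution ::
    "real \<Rightarrow> real \<Rightarrow> real \<Rightarrow> (real \<Rightarrow> real) \<Rightarrow> (real \<Rightarrow> real \<Rightarrow> real) \<Rightarrow> bool"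
  where "global_weak_solution k1 k2 k3 u0 u \<longleftrightarrow> (\<forall>T>0. weak_solution k1 k2 k3 T u0 u)"

definition peakon :: "real \<Rightarrow> real \<Rightarrow> real \<Rightarrow> real \<Rightarrow> real"
  where "peakon a c t x = a * cosh (1/2 - (x - c * t) + of_int \<lfloor>x - c * t\<rfloor>)"

end

theory Submission
  imports Defs "HOL-Real_Asymp.Real_Asymp"
begin

text \<open>
  Write \<open>C = cosh b\<close> and \<open>S = sinh b\<close> with \<open>b = frac (x - c t) - 1/2\<close>. The peakon is \<open>u = a C\<close>, and
  its weak derivative is \<open>a S\<close>: the two ends of the profile agree, so \<open>u\<close> is continuous and only its
  slope jumps, at the crest. All coefficients of \<open>\<phi>\<close> and its derivatives in the weak formulation are
  therefore profiles carried along at speed \<open>c\<close>, and the formulation splits as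
  \<open>\<integral>\<integral> u (\<phi>\<^sub>t + c \<phi>\<^sub>x) + \<integral>\<integral> ((F - c u) \<phi>\<^sub>x + H \<phi>) + \<integral> u\<^sub>0 \<phi>(0,\<cdot>) = 0\<close>, where the flux \<open>F\<close>
  collects everything multiplied by \<open>\<phi>\<^sub>x\<close> and the source \<open>H\<close> everything multiplied by \<open>\<phi>\<close>.

  The first integral cancels the third for every continuous profile and every speed: seen from the
  moving frame, \<open>\<phi>\<^sub>t + c \<phi>\<^sub>x\<close> is a total time derivative (\<open>transport_integral\<close>). The second integral
  vanishes for each fixed \<open>t\<close>, by one integration by parts over a period
  (\<open>wave_integral_by_parts\<close>), provided that \<open>F - c u\<close> is continuous across the crest and
  \<open>(F - c u)' = H\<close> away from it. This is where the value of \<open>c\<close> enters (\<open>peakon_flux_deriv\<close>).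

  To check that identity the convolutions have to be known. Convolution with \<open>G\<close> inverts \<open>1 - \<partial>\<^sub>x\<^sup>2\<close>
  among functions that are \<open>C\<^sup>1\<close> on the circle (\<open>circle_conv_green_wave\<close>), so it suffices to guess the
  solution for the three right-hand sides \<open>S\<^sup>3\<close>, \<open>2 C\<^sup>3 + 3 C S\<^sup>2\<close> and \<open>C\<^sup>2 + S\<^sup>2/2\<close>. The first two
  contain a resonant multiple of \<open>S\<close> or \<open>C\<close>, hence secular terms \<open>b C\<close> and \<open>b S\<close>; these cancel in
  \<open>F' - H\<close>, where the convolution multiplying \<open>\<phi>\<^sub>x\<close> is differentiated and the one multiplying \<open>\<phi>\<close>
  is not. The nonlocal part of \<open>F' - H\<close> that is left is
  \<open>(k\<^sub>1/3 + k\<^sub>2/2) a\<^sup>3 \<cdot> 2 (cosh\<^sup>2(1/2) - C\<^sup>2) S + k\<^sub>3 a\<^sup>2 (cosh(1/2) - C) S\<close>. The local terms of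
  \<open>F' - H\<close> cancel every product of \<open>S\<close> with a positive power of \<open>C\<close>, and \<open>c a S\<close> remains.

  Two points belong to the functional setting. The weak derivative is a choice, so it has to be
  shown that any two weak derivatives agree almost everywhere (\<open>has_weak_deriv_unique\<close>). And the
  curve \<open>t \<mapsto> u t\<close> has constant norm in \<open>W\<^sup>1\<^sup>,\<^sup>3\<close> and is continuous there because translation is
  (\<open>tendsto_W13_norm_translate\<close>), hence it is strongly measurable and bounded.
\<close>


section \<open>Integration over the circle\<close>

lemma finite_measure_circle: "finite_measure circle"
  by (intro finite_measure_lebesgue_on bounded_set_imp_lmeasurable) auto

lemma borel_measurable_circleI: "f \<in> borel_measurable borel \<Longrightarrow> f \<in> borel_measurable circle"
  by (intro measurable_restrict_space1 measurable_completion) simp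

lemma integrable_circle_bounded:
  fixes f :: "real \<Rightarrow> real"
  assumes "f \<in> borel_measurable circle" and "\<And>x. x \<in> {0..<1} \<Longrightarrow> \<bar>f x\<bar> \<le> B"
  shows "integrable circle f"
  using assms
  by (intro finite_measure.integrable_const_bound[OF finite_measure_circle, of _ B] AE_I2) auto

lemma AE_circle_avoid_countable:
  assumes "countable A"
  shows "AE x in circle. x \<notin> A"
proof -
  have "A \<in> null_sets lebesgue"
    using assms by (intro null_sets_completionI countable_imp_null_set_lborel)
  then have "AE x in lebesgue. x \<notin> A" by (rule AE_not_in)
  then show ?thesis by (auto simp: AE_restrict_space_iff)
qed

text \<open>
  Integrands given by a profile on a period are continuous on \<open>[0,1]\<close> but, extended periodically,
  may jump at the integers. The end point is a null set, so the integral over the circle may be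
  computed from the continuous profile \<open>h\<close> by the fundamental theorem of calculus.
\<close>

lemma circle_integral_continuous:
  fixes g h :: "real \<Rightarrow> real"
  assumes h: "continuous_on {0..1} h" and gh: "\<And>x. x \<in> {0..<1} \<Longrightarrow> g x = h x"
  shows "integrable circle g" and "(LINT x|circle. g x) = integral {0..1} h"
proof -
  have "integrable (lebesgue_on {0..1}) h" using h by (rule continuous_imp_integrable_real)
  then have "set_integrable lebesgue {0..1} h"
    by (simp add: integrable_restrict_space set_integrable_def)
  then have "set_integrable lebesgue {0..<1} h"
    by (rule set_integrable_subset) auto
  then have ih: "integrable circle h"
    by (simp add: integrable_restrict_space set_integrable_def)
  then show "integrable circle g"
    by (subst Bochner_Integration.integrable_cong[OF refl, of _ g h]) (auto simp: gh)
  have "(LINT x|circle. g x) = (LINT x|circle. h x)"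
    by (rule Bochner_Integration.integral_cong) (auto simp: gh)
  also have "\<dots> = integral {0..<1} h" using ih by (rule lebesgue_integral_eq_integral) simp
  also have "\<dots> = integral {0..1} h"
    by (rule integral_spike_set; rule negligible_subset[of "{1}"]) auto
  finally show "(LINT x|circle. g x) = integral {0..1} h" .
qed

lemma period_one_add_int:
  assumes "period_one f" shows "f (x + of_int n) = f x"
proof -
  have p: "f (y + 1) = f y" for y using assms by (simp add: period_one_def)
  show ?thesis
  proof (induction n rule: int_induct[where k = 0])
    case (step1 i)
    then show ?case using p[of "x + of_int i"] by (simp add: algebra_simps)
  next
    case (step2 i)
    then show ?case using p[of "x + of_int i - 1"] by (simp add: algebra_simps)
  qed simp
qed

lemma period_one_derivative:
  assumes per: "period_one \<psi>" and \<psi>: "\<And>x. (\<psi> has_real_derivative \<psi>' x) (at x)"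
  shows "period_one \<psi>'"
  unfolding period_one_def
proof
  fix x
  have "((\<lambda>y. \<psi> (y + 1)) has_real_derivative \<psi>' (x + 1)) (at x)"
    using \<psi>[of "x + 1"] by (simp add: DERIV_shift)
  moreover have "(\<lambda>y. \<psi> (y + 1)) = \<psi>" using per by (auto simp: period_one_def)
  ultimately have "(\<psi> has_real_derivative \<psi>' (x + 1)) (at x)" by simp
  then show "\<psi>' (x + 1) = \<psi>' x" using \<psi> by (rule DERIV_unique)
qed

lemma LINT_circle_eq_set: "(LINT x|circle. g x) = (LINT x:{0..<1}|lebesgue. g (x::real) :: real)"
  by (simp add: integral_restrict_space set_lebesgue_integral_def)

lemma integrable_circle_iff_set:
  "integrable circle g \<longleftrightarrow> set_integrable lebesgue {0..<1} (g :: real \<Rightarrow> real)"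
  by (simp add: integrable_restrict_space set_integrable_def)

lemma set_lebesgue_integral_shift:
  fixes g :: "real \<Rightarrow> real"
  shows "(LINT x:{a..<b}|lebesgue. g (x + r)) = (LINT x:{a+r..<b+r}|lebesgue. g x)"
proof -
  have "(LINT x:{a+r..<b+r}|lebesgue. g x)
      = (LINT x|lebesgue. indicator {a+r..<b+r} (r + 1 * x) *\<^sub>R g (r + 1 * x))"
    unfolding set_lebesgue_integral_def
    using lebesgue_integral_real_affine[of 1 "\<lambda>x. indicator {a+r..<b+r} x *\<^sub>R g x" r] by simp
  also have "\<dots> = (LINT x:{a..<b}|lebesgue. g (x + r))"
    unfolding set_lebesgue_integral_def
    by (rule Bochner_Integration.integral_cong) (auto simp: indicator_def algebra_simps)
  finally show ?thesis by simp
qed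

text \<open>
  Translation invariance of the circle: after reducing the shift modulo the period, the part of
  the shifted interval that sticks out at the right end is moved back by one period.
\<close>

lemma circle_integral_shift:
  fixes g :: "real \<Rightarrow> real"
  assumes per: "period_one g" and int: "integrable circle g"
  shows "(LINT x|circle. g (x - s)) = (LINT x|circle. g x)"
proof -
  \<comment> \<open>Shifting by \<open>-s\<close> is shifting by some \<open>r\<close> in \<open>(0,1]\<close>.\<close>
  define r where "r = 1 - frac s"
  have r: "0 < r" "r \<le> 1" by (simp_all add: r_def frac_lt_1 less_eq_real_def)
  have gs: "g (x - s) = g (x + r)" for x
    using period_one_add_int[OF per, of "x - s" "\<lfloor>s\<rfloor> + 1"] by (simp add: r_def frac_def algebra_simps)
  have si: "set_integrable lebesgue S g" if "S \<subseteq> {0..<1}" "S \<in> sets lebesgue" for S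
    using int that by (auto simp: integrable_circle_iff_set intro: set_integrable_subset)
  have top: "set_integrable lebesgue {1..<1+r} g"
  proof -
    have "integrable lebesgue (\<lambda>x. indicator {0..<r} x *\<^sub>R g x)"
      using si[of "{0..<r}"] r by (auto simp: set_integrable_def)
    then have "integrable lebesgue (\<lambda>x. indicator {0..<r} (-1 + 1 * x) *\<^sub>R g (-1 + 1 * x))"
      using lebesgue_integrable_real_affine_iff[of 1 "\<lambda>x. indicator {0..<r} x *\<^sub>R g x" "-1"] by simp
    moreover have "indicator {0..<r} (-1 + 1 * x) *\<^sub>R g (-1 + 1 * x) = indicator {1..<1+r} x *\<^sub>R g x" for x
      using period_one_add_int[OF per, of "x" "-1"] by (auto simp: indicator_def)
    ultimately show ?thesis by (simp add: set_integrable_def)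
  qed
  have "(LINT x|circle. g (x - s)) = (LINT x:{0..<1}|lebesgue. g (x + r))"
    by (simp add: gs LINT_circle_eq_set)
  also have "\<dots> = (LINT x:{r..<1+r}|lebesgue. g x)"
    using set_lebesgue_integral_shift[of 0 1 g r] by simp
  also have "{r..<1+r} = {r..<1} \<union> {1..<1+r}" using r by auto
  also have "(LINT x:{r..<1} \<union> {1..<1+r}|lebesgue. g x)
      = (LINT x:{r..<1}|lebesgue. g x) + (LINT x:{1..<1+r}|lebesgue. g x)"
    using r by (intro set_integral_Un si top) auto
  also have "(LINT x:{1..<1+r}|lebesgue. g x) = (LINT x:{0..<r}|lebesgue. g x)"
    using set_lebesgue_integral_shift[of 0 r g 1] per by (simp add: period_one_def add.commute)
  also have "(LINT x:{r..<1}|lebesgue. g x) + (LINT x:{0..<r}|lebesgue. g x)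
      = (LINT x:{r..<1} \<union> {0..<r}|lebesgue. g x)"
    using r by (intro set_integral_Un[symmetric] si) auto
  also have "{r..<1} \<union> {0..<r} = {0..<1}" using r by auto
  finally show ?thesis by (simp add: LINT_circle_eq_set)
qed


section \<open>Functions orthogonal to all smooth periodic functions\<close>

text \<open>
  A smooth periodic approximation, as \<open>n\<close> grows, of the indicator of the arc on which
  \<open>cos (2 \<pi> x - p) > q\<close>.
\<close>

definition sigmoid :: "real \<Rightarrow> real \<Rightarrow> real \<Rightarrow> real \<Rightarrow> real"
  where "sigmoid n p q x = 1 / (1 + exp (n * (q - cos (2 * pi * x - p))))"

text \<open>
  Smoothness of the sigmoid is shown by exhibiting an algebra of functions that contains it and is
  closed under differentiation: since \<open>\<sigma>' = \<sigma> (1 - \<sigma>)\<close> up to the factor from the inner function,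
  polynomials in \<open>\<sigma>\<close>, sine and cosine suffice.
\<close>

inductive_set sigmoid_algebra :: "real \<Rightarrow> real \<Rightarrow> real \<Rightarrow> (real \<Rightarrow> real) set" for n p q
  where
    const: "(\<lambda>_. r) \<in> sigmoid_algebra n p q"
  | sine: "(\<lambda>x. sin (2 * pi * x - p)) \<in> sigmoid_algebra n p q"
  | cosine: "(\<lambda>x. cos (2 * pi * x - p)) \<in> sigmoid_algebra n p q"
  | sigmoid: "sigmoid n p q \<in> sigmoid_algebra n p q"
  | add: "f \<in> sigmoid_algebra n p q \<Longrightarrow> g \<in> sigmoid_algebra n p q \<Longrightarrow>
            (\<lambda>x. f x + g x) \<in> sigmoid_algebra n p q"
  | mult: "f \<in> sigmoid_algebra n p q \<Longrightarrow> g \<in> sigmoid_algebra n p q \<Longrightarrow>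
            (\<lambda>x. f x * g x) \<in> sigmoid_algebra n p q"

lemma sigmoid_has_derivative:
  "(sigmoid n p q has_real_derivative
     (- (2 * pi * n) * sin (2 * pi * x - p)) * (sigmoid n p q x * (1 + - 1 * sigmoid n p q x))) (at x)"
proof -
  have pos: "1 + exp (n * (q - cos (2 * pi * x - p))) > 0" for x
    by (simp add: add_pos_pos)
  show ?thesis
    unfolding sigmoid_def
    apply (rule derivative_eq_intros refl | simp add: less_imp_neq[OF pos, symmetric])+
    using pos[of x] by (simp add: divide_simps algebra_simps power2_eq_square)
qed

lemma sigmoid_algebra_deriv:
  assumes "f \<in> sigmoid_algebra n p q"
  shows "\<exists>g\<in>sigmoid_algebra n p q. \<forall>x. (f has_real_derivative g x) (at x)"
  using assms
proof induction
  case (const r)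
  show ?case by (rule bexI[OF _ sigmoid_algebra.const[of 0]]) auto
next
  case sine
  show ?case
    by (rule bexI[OF _ sigmoid_algebra.mult[OF sigmoid_algebra.const[of "2 * pi"] sigmoid_algebra.cosine]])
      (auto intro!: derivative_eq_intros)
next
  case cosine
  show ?case
    by (rule bexI[OF _ sigmoid_algebra.mult[OF sigmoid_algebra.const[of "- (2 * pi)"] sigmoid_algebra.sine]])
      (auto intro!: derivative_eq_intros)
next
  case sigmoid
  show ?case
    by (rule bexI[OF _ sigmoid_algebra.mult[OF
            sigmoid_algebra.mult[OF sigmoid_algebra.const[of "- (2 * pi * n)"] sigmoid_algebra.sine]
            sigmoid_algebra.mult[OF sigmoid_algebra.sigmoid sigmoid_algebra.add[OF sigmoid_algebra.const[of 1]
              sigmoid_algebra.mult[OF sigmoid_algebra.const[of "- 1"] sigmoid_algebra.sigmoid]]]]])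
      (intro allI sigmoid_has_derivative)
next
  case (add f g)
  then obtain f' g' where "f' \<in> sigmoid_algebra n p q" "g' \<in> sigmoid_algebra n p q"
    "\<forall>x. (f has_real_derivative f' x) (at x)" "\<forall>x. (g has_real_derivative g' x) (at x)" by blast
  then show ?case
    by (intro bexI[of _ "\<lambda>x. f' x + g' x"]) (auto intro: sigmoid_algebra.intros derivative_eq_intros)
next
  case (mult f g)
  then obtain f' g' where "f' \<in> sigmoid_algebra n p q" "g' \<in> sigmoid_algebra n p q"
    "\<forall>x. (f has_real_derivative f' x) (at x)" "\<forall>x. (g has_real_derivative g' x) (at x)" by blast
  with mult.hyps show ?case
    by (intro bexI[of _ "\<lambda>x. f' x * g x + g' x * f x"])
      (auto intro!: sigmoid_algebra.add sigmoid_algebra.mult intro: DERIV_mult)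
qed

lemma smooth_periodic_sigmoid: "smooth_periodic (sigmoid n p q)"
proof -
  have mem: "(deriv ^^ k) (sigmoid n p q) \<in> sigmoid_algebra n p q" for k
  proof (induction k)
    case (Suc k)
    then obtain g where g: "g \<in> sigmoid_algebra n p q"
      "\<forall>x. ((deriv ^^ k) (sigmoid n p q) has_real_derivative g x) (at x)"
      using sigmoid_algebra_deriv by blast
    then have "deriv ((deriv ^^ k) (sigmoid n p q)) = g" by (intro ext DERIV_imp_deriv) auto
    with g show ?case by simp
  qed (simp add: sigmoid_algebra.sigmoid)
  have "cos (2 * pi * (x + 1) - p) = cos (2 * pi * x - p)" for x
    using cos_periodic[of "2 * pi * x - p"] by (simp add: algebra_simps)
  then have "period_one (sigmoid n p q)" by (simp add: period_one_def sigmoid_def)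
  with mem sigmoid_algebra_deriv show ?thesis
    unfolding smooth_periodic_def by (meson real_differentiable_def)
qed

lemma sigmoid_tendsto:
  assumes ab: "0 \<le> \<alpha>" "\<alpha> < \<beta>" "\<beta> \<le> 1" and x: "x \<in> {0..<1}" "x \<notin> {0, \<alpha>, \<beta>}"
  shows "(\<lambda>n. sigmoid (real n) (pi * (\<alpha> + \<beta>)) (cos (pi * (\<beta> - \<alpha>))) x) \<longlonglongrightarrow> indicator {\<alpha><..<\<beta>} x"
proof -
  define d where "d = cos (2 * pi * x - pi * (\<alpha> + \<beta>)) - cos (pi * (\<beta> - \<alpha>))"
  \<comment> \<open>In this form the sign of \<open>d\<close> on each side of \<open>\<alpha>\<close> and \<open>\<beta>\<close> is visible.\<close>
  have d: "d = 2 * sin (pi * (x - \<alpha>)) * sin (pi * (\<beta> - x))"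
    unfolding d_def cos_diff_cos
    by (simp add: algebra_simps flip: sin_minus) (simp add: add_divide_distrib diff_divide_distrib algebra_simps)
  have sp: "sin (pi * y) > 0" if "0 < y" "y < 1" for y
    using that by (intro sin_gt_zero) auto
  have sn: "sin (pi * y) < 0" if "-1 < y" "y < 0" for y
    using sp[of "-y"] that by simp
  have eq: "sigmoid (real n) (pi * (\<alpha> + \<beta>)) (cos (pi * (\<beta> - \<alpha>))) x = 1 / (1 + exp (- d * real n))" for n
    by (simp add: sigmoid_def d_def algebra_simps)
  show ?thesis
  proof (cases "x \<in> {\<alpha><..<\<beta>}")
    case True
    have "d > 0" unfolding d using sp[of "x - \<alpha>"] sp[of "\<beta> - x"] True ab x by simp
    then have "(\<lambda>n. 1 / (1 + exp (- d * real n))) \<longlonglongrightarrow> 1" by real_asymp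
    with True show ?thesis by (simp add: eq)
  next
    case False
    then have "x < \<alpha> \<or> x > \<beta>" using x by auto
    then have "d < 0"
    proof
      assume "x < \<alpha>"
      then have "sin (pi * (x - \<alpha>)) < 0" "sin (pi * (\<beta> - x)) > 0"
        using ab x by (auto intro!: sn sp)
      then show ?thesis unfolding d by (simp add: mult_neg_pos)
    next
      assume "x > \<beta>"
      then have "sin (pi * (x - \<alpha>)) > 0" "sin (pi * (\<beta> - x)) < 0"
        using ab x by (auto intro!: sn sp)
      then show ?thesis unfolding d by (simp add: mult_pos_neg)
    qed
    then have "(\<lambda>n. 1 / (1 + exp (- d * real n))) \<longlonglongrightarrow> 0" by real_asymp
    with False show ?thesis by (simp add: eq)
  qed
qed

text \<open>
  Dominated convergence: the sigmoids for the arc between \<open>\<alpha>\<close> and \<open>\<beta>\<close> are bounded by one.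
\<close>

lemma integral_interval_eq_0:
  assumes h: "integrable circle h"
    and orth: "\<And>\<psi>. smooth_periodic \<psi> \<Longrightarrow> (LINT x|circle. h x * \<psi> x) = 0"
    and ab: "0 \<le> \<alpha>" "\<alpha> < \<beta>" "\<beta> \<le> 1"
  shows "(LINT x|circle. h x * indicator {\<alpha><..<\<beta>} x) = 0"
proof -
  let ?s = "\<lambda>n x. sigmoid (real n) (pi * (\<alpha> + \<beta>)) (cos (pi * (\<beta> - \<alpha>))) x"
  have [measurable]: "h \<in> borel_measurable circle" using h by simp
  have [measurable]: "(\<lambda>x. x) \<in> borel_measurable circle" by (rule borel_measurable_circleI) simp
  have [measurable]: "?s n \<in> borel_measurable circle" for n unfolding sigmoid_def by measurable
  have "(\<lambda>n. LINT x|circle. h x * ?s n x) \<longlonglongrightarrow> (LINT x|circle. h x * indicator {\<alpha><..<\<beta>} x)"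
  proof (rule integral_dominated_convergence[where w = "\<lambda>x. \<bar>h x\<bar>"])
    show "(\<lambda>x. h x * indicat_real {\<alpha><..<\<beta>} x) \<in> borel_measurable circle"
      by measurable
    show "AE x in circle. (\<lambda>n. h x * ?s n x) \<longlonglongrightarrow> h x * indicator {\<alpha><..<\<beta>} x"
    proof -
      have "AE x in circle. x \<notin> {0,\<alpha>,\<beta>}" by (rule AE_circle_avoid_countable) simp
      with AE_space[of circle] show ?thesis
        by eventually_elim (intro tendsto_mult tendsto_const sigmoid_tendsto[OF ab]; simp)
    qed
    have "\<bar>?s n x\<bar> \<le> 1" for n x by (simp add: sigmoid_def divide_simps add_pos_pos)
    then show "AE x in circle. norm (h x * ?s n x) \<le> \<bar>h x\<bar>" for n
      by (auto simp: abs_mult intro!: mult_left_le)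
  qed (use h in auto)
  moreover have "(LINT x|circle. h x * ?s n x) = 0" for n
    by (rule orth[OF smooth_periodic_sigmoid])
  ultimately show ?thesis by (simp add: LIMSEQ_const_iff)
qed

text \<open>
  The signed measure with density \<open>h\<close> vanishes on intervals. These generate the Borel sets and
  are stable under intersection, so it vanishes on all Borel sets, and Lebesgue sets differ from
  Borel sets by null sets only.
\<close>

lemma AE_circle_eq_0_if_orthogonal:
  assumes h: "integrable circle h"
    and orth: "\<And>\<psi>. smooth_periodic \<psi> \<Longrightarrow> (LINT x|circle. h x * \<psi> x) = 0"
  shows "AE x in circle. h x = 0"
proof -
  interpret finite_measure circle by (rule finite_measure_circle)
  have mh: "h \<in> borel_measurable circle" using h by simp
  have ind: "indicator A \<in> borel_measurable circle" if "A \<in> sets lebesgue" for A :: "real set"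
    using that by (intro measurable_restrict_space1 borel_measurable_indicator)
  have int: "integrable circle (\<lambda>x. indicator A x * h x)" if "A \<in> sets lebesgue" for A
  proof (rule Bochner_Integration.integrable_bound[OF h])
    show "(\<lambda>x. indicator A x * h x) \<in> borel_measurable circle"
      using ind[OF that] mh by (rule borel_measurable_times)
  qed (auto simp: indicator_def)
  have null: "(LINT x|circle. indicator A x * h x) = (LINT x|circle. indicator B x * h x)"
    if "A \<in> sets lebesgue" "B \<in> sets lebesgue" "AE x in circle. x \<in> A \<longleftrightarrow> x \<in> B" for A B
  proof (rule integral_cong_AE)
    show "AE x in circle. indicator A x * h x = indicator B x * h x"
      using that(3) by eventually_elim (auto simp: indicator_def)
  qed (intro borel_measurable_times ind mh that)+
  have AE01: "AE x in circle. 0 < x \<and> x < 1"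
  proof -
    have "AE x in circle. x \<notin> {0}" by (rule AE_circle_avoid_countable) simp
    with AE_space[of circle] show ?thesis by eventually_elim auto
  qed
  have open01: "(LINT x|circle. indicator {0<..<1} x * h x) = 0"
    using integral_interval_eq_0[OF h orth, of 0 1] by (simp add: mult.commute)
  have total: "(LINT x|circle. h x) = 0"
  proof -
    have "AE x in circle. x \<in> UNIV \<longleftrightarrow> x \<in> {0<..<1}"
      using AE01 by eventually_elim auto
    from null[OF _ _ this] open01 show ?thesis by simp
  qed
  have borel0: "(LINT x|circle. indicator A x * h x) = 0" if "A \<in> sets borel" for A :: "real set"
  proof -
    let ?E = "range (\<lambda>(a, b). box a b :: real set)"
    have E: "Int_stable ?E" "?E \<subseteq> Pow UNIV" by (auto simp: Int_stable_def box_Int_box)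
    have "A \<in> sigma_sets UNIV ?E" using that by (simp add: borel_eq_box)
    from E this show ?thesis
    proof (induction rule: sigma_sets_induct_disjoint)
      case (basic A)
      then obtain a b where A: "A = {a<..<b}" by (auto simp: box_real)
      have "AE x in circle. x \<in> A \<longleftrightarrow> x \<in> {max a 0<..<min b 1}"
        using AE01 by eventually_elim (auto simp: A)
      from null[OF _ _ this] A
      have "(LINT x|circle. indicator A x * h x)
          = (LINT x|circle. indicator {max a 0<..<min b 1} x * h x)" by simp
      also have "\<dots> = 0"
      proof (cases "max a 0 < min b 1")
        case True
        then show ?thesis
          using integral_interval_eq_0[OF h orth, of "max a 0" "min b 1"] by (simp add: mult.commute)
      next
        case False
        then have "{max a 0<..<min b 1} = {}" by (simp only: greaterThanLessThan_empty_iff not_less)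
        then have "indicat_real {max a 0<..<min b 1} x = 0" for x by (simp only: indicator_def) simp
        then show ?thesis by (simp only: mult_zero_left Bochner_Integration.integral_zero)
      qed
      finally show ?case .
    next
      case (compl A)
      then have A: "A \<in> sets borel" by (simp add: borel_eq_box)
      have "(LINT x|circle. indicator (UNIV - A) x * h x) = (LINT x|circle. h x - indicator A x * h x)"
        by (rule Bochner_Integration.integral_cong) (auto simp: indicator_def)
      also have "\<dots> = 0"
        using compl total h int[of A] A by (subst Bochner_Integration.integral_diff) auto
      finally show ?case .
    next
      case (union A)
      then have A: "A i \<in> sets lebesgue" for i
        by (auto simp: borel_eq_box image_subset_iff)
      have "set_integrable lebesgue (\<Union>i. A i \<inter> {0..<1}) h"
        by (rule set_integrable_subset[of _ "{0..<1}"]) (use h A in \<open>auto simp: integrable_circle_iff_set\<close>)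
      then have "(LINT x:(\<Union>i. A i \<inter> {0..<1})|lebesgue. h x) = (\<Sum>i. LINT x:A i \<inter> {0..<1}|lebesgue. h x)"
        using union(1) A
        by (intro lebesgue_integral_countable_add) (auto simp: disjoint_family_on_def)
      moreover have "(LINT x:B \<inter> {0..<1}|lebesgue. h x) = (LINT x|circle. indicator B x * h x)" for B
        by (simp add: LINT_circle_eq_set set_lebesgue_integral_def indicator_inter_arith mult_ac)
      ultimately show ?case using union by (simp flip: Int_UN_distrib2)
    qed simp
  qed
  have "set_lebesgue_integral circle A h = 0" if "A \<in> sets circle" for A
  proof -
    have A: "A \<in> sets lebesgue" using that by (auto simp: sets_restrict_space_iff)
    then obtain S N N' where S: "A = S \<union> N" "N \<subseteq> N'" "N' \<in> null_sets lborel" "S \<in> sets lborel"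
      by (rule sets_completionE)
    have "AE x in lebesgue. x \<notin> N'" using S(3) by (intro AE_not_in null_sets_completionI)
    then have "AE x in circle. x \<in> A \<longleftrightarrow> x \<in> S"
      using S(1,2) by (auto simp: AE_restrict_space_iff elim!: eventually_mono)
    from null[OF A _ this] S(4) borel0[of S] show ?thesis
      by (simp add: set_lebesgue_integral_def)
  qed
  then show ?thesis by (rule density_zero[OF h])
qed


section \<open>Weak derivatives\<close>

lemma smooth_periodic_DERIV:
  assumes "smooth_periodic \<psi>"
  shows "(\<psi> has_real_derivative deriv \<psi> x) (at x)"
proof -
  have "(deriv ^^ 0) \<psi> differentiable at x" using assms unfolding smooth_periodic_def by blast
  then show ?thesis by (simp add: DERIV_deriv_iff_real_differentiable)
qed

lemma smooth_periodic_continuous: "smooth_periodic \<psi> \<Longrightarrow> continuous_on UNIV \<psi>"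
  by (intro continuous_at_imp_continuous_on ballI DERIV_isCont[OF smooth_periodic_DERIV])

lemma smooth_periodic_continuous_deriv:
  assumes "smooth_periodic \<psi>"
  shows "continuous_on UNIV (deriv \<psi>)"
proof -
  have "(deriv ^^ 1) \<psi> differentiable at x" for x using assms unfolding smooth_periodic_def by blast
  then show ?thesis by (auto intro!: continuous_at_imp_continuous_on differentiable_imp_continuous_within)
qed

lemma integrable_circle_mult_continuous:
  assumes h: "integrable circle h" and \<psi>: "continuous_on UNIV (\<psi> :: real \<Rightarrow> real)"
  shows "integrable circle (\<lambda>x. h x * \<psi> x)"
proof -
  have "compact (\<psi> ` {0..1})"
    by (intro compact_continuous_image continuous_on_subset[OF \<psi>]) auto
  then obtain B where B: "\<And>x. x \<in> {0..1} \<Longrightarrow> norm (\<psi> x) \<le> B"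
    by (meson bounded_iff compact_imp_bounded imageI)
  have [measurable]: "\<psi> \<in> borel_measurable circle" "h \<in> borel_measurable circle"
    using h \<psi> by (auto intro: borel_measurable_circleI borel_measurable_continuous_onI)
  show ?thesis
  proof (rule Bochner_Integration.integrable_bound[where f = "\<lambda>x. \<bar>B\<bar> * h x"])
    show "AE x in circle. norm (h x * \<psi> x) \<le> norm (\<bar>B\<bar> * h x)"
    proof (rule AE_I2)
      fix x assume "x \<in> space circle"
      then have "\<bar>\<psi> x\<bar> \<le> \<bar>B\<bar>" using B[of x] by simp
      then show "norm (h x * \<psi> x) \<le> norm (\<bar>B\<bar> * h x)"
        by (simp add: abs_mult mult.commute mult_right_mono)
    qed
  qed (use h in \<open>auto\<close>)
qed

lemma has_weak_deriv_unique:
  assumes g1: "has_weak_deriv f g1" and g2: "has_weak_deriv f g2"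
  shows "AE x in circle. g1 x = g2 x"
proof -
  have i: "integrable circle g1" "integrable circle g2"
    using g1 g2 by (auto simp: has_weak_deriv_def)
  have "AE x in circle. g1 x - g2 x = 0"
  proof (rule AE_circle_eq_0_if_orthogonal)
    fix \<psi> assume \<psi>: "smooth_periodic \<psi>"
    have "(LINT x|circle. g1 x * \<psi> x) = (LINT x|circle. g2 x * \<psi> x)"
      using g1 g2 \<psi> by (simp add: has_weak_deriv_def)
    then show "(LINT x|circle. (g1 x - g2 x) * \<psi> x) = 0"
      using integrable_circle_mult_continuous[OF _ smooth_periodic_continuous[OF \<psi>]] i
      by (simp add: left_diff_distrib)
  qed (use i in auto)
  then show ?thesis by simp
qed

text \<open>
  Under an integral, the chosen weak derivative may be replaced by any explicit one.
\<close>

lemma AE_weak_deriv: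
  assumes "has_weak_deriv f g"
  shows "AE x in circle. weak_deriv f x = g x" and "weak_deriv f \<in> borel_measurable circle"
proof -
  have w: "has_weak_deriv f (weak_deriv f)"
    unfolding weak_deriv_def using someI[of "has_weak_deriv f", OF assms] by simp
  then show "AE x in circle. weak_deriv f x = g x" using assms by (rule has_weak_deriv_unique)
  show "weak_deriv f \<in> borel_measurable circle" using w by (auto simp: has_weak_deriv_def)
qed

lemma has_weak_deriv_diff:
  assumes f: "has_weak_deriv f f'" and g: "has_weak_deriv g g'"
  shows "has_weak_deriv (\<lambda>x. f x - g x) (\<lambda>x. f' x - g' x)"
  unfolding has_weak_deriv_def
proof (intro conjI allI impI)
  fix \<psi> assume \<psi>: "smooth_periodic \<psi>"
  note int = integrable_circle_mult_continuous[OF _ smooth_periodic_continuous[OF \<psi>]]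
    integrable_circle_mult_continuous[OF _ smooth_periodic_continuous_deriv[OF \<psi>]]
  show "(LINT x|circle. (f x - g x) * deriv \<psi> x) = - (LINT x|circle. (f' x - g' x) * \<psi> x)"
    using f g \<psi> int by (simp add: has_weak_deriv_def left_diff_distrib)
qed (use f g in \<open>auto simp: has_weak_deriv_def period_one_def\<close>)


section \<open>Translates of a periodic profile\<close>

lemma period_one_wave: "period_one (\<lambda>x. p (frac (x - s)))"
proof -
  have "x + 1 - s = (x - s) + 1" for x by simp
  then show ?thesis by (simp only: period_one_def frac_1_eq) simp
qed

text \<open>
  The functions \<open>x \<mapsto> p (frac (x - s))\<close> are the translates of the periodic extension of the
  restriction of \<open>p\<close> to \<open>[0,1)\<close>. They are continuous only if \<open>p 0 = p 1\<close>, but measurable, bounded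
  and integrable over the circle in any case.
\<close>

lemma wave_measurable:
  assumes "continuous_on UNIV (p :: real \<Rightarrow> real)"
  shows "(\<lambda>x. p (frac (x - s))) \<in> borel_measurable borel"
proof -
  have [measurable]: "p \<in> borel_measurable borel" using assms by (rule borel_measurable_continuous_onI)
  show ?thesis unfolding frac_def by measurable
qed

lemma wave_bounded:
  assumes "continuous_on UNIV (p :: real \<Rightarrow> real)"
  obtains B where "\<And>x. \<bar>p (frac x)\<bar> \<le> B"
proof -
  have "compact (p ` {0..1})"
    by (intro compact_continuous_image continuous_on_subset[OF assms]) auto
  then obtain B where B: "\<And>x. x \<in> {0..1} \<Longrightarrow> norm (p x) \<le> B"
    by (meson bounded_iff compact_imp_bounded imageI)
  have "frac x \<in> {0..1}" for x :: real by (simp add: frac_lt_1 less_imp_le)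
  with B that show thesis by (metis real_norm_def)
qed

lemma integrable_circle_wave:
  assumes p: "continuous_on UNIV (p :: real \<Rightarrow> real)"
  shows "integrable circle (\<lambda>x. p (frac (x - s)))"
proof -
  obtain B where "\<And>x. \<bar>p (frac x)\<bar> \<le> B" using wave_bounded[OF p] by blast
  then show ?thesis
    by (intro integrable_circle_bounded borel_measurable_circleI wave_measurable p)
qed

text \<open>
  The change of variables \<open>z = x - s\<close> to the frame of the wave, in which the profile is smooth on the
  closed period and the singularity sits at its ends.
\<close>

lemma circle_integral_comoving:
  fixes G :: "real \<Rightarrow> real \<Rightarrow> real"
  assumes per: "\<And>y. period_one (G y)" and cont: "continuous_on {0..1} (\<lambda>z. G z (z + s))"
  shows "(LINT x|circle. G (frac (x - s)) x) = integral {0..1} (\<lambda>z. G z (z + s))"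
proof -
  define g where "g z = G (frac z) (z + s)" for z
  have g: "g z = G z (z + s)" if "z \<in> {0..<1}" for z
    using that by (simp add: g_def frac_eq[THEN iffD2])
  have perg: "period_one g"
  proof -
    have "z + 1 + s = (z + s) + 1" for z by simp
    with per show ?thesis by (simp only: g_def period_one_def frac_1_eq) simp
  qed
  have "(LINT x|circle. G (frac (x - s)) x) = (LINT x|circle. g (x - s))"
    by (simp add: g_def)
  also have "\<dots> = (LINT x|circle. g x)"
    by (rule circle_integral_shift[OF perg circle_integral_continuous(1)[OF cont g]])
  also have "\<dots> = integral {0..1} (\<lambda>z. G z (z + s))"
    by (rule circle_integral_continuous(2)[OF cont g])
  finally show ?thesis .
qed

lemma continuous_on_mult_shift:
  fixes p E :: "real \<Rightarrow> real"
  assumes p: "continuous_on UNIV p" and E: "continuous_on UNIV E"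
  shows "continuous_on A (\<lambda>z. p z * E (z + s))"
proof -
  have "continuous_on A (\<lambda>z. z + s)" by (intro continuous_intros)
  from continuous_on_mult[OF continuous_on_subset[OF p subset_UNIV] continuous_on_compose2[OF E this subset_UNIV]]
  show ?thesis .
qed

lemma circle_integral_wave_mult:
  assumes p: "continuous_on UNIV p" and E: "continuous_on UNIV E" and per: "period_one E"
  shows "(LINT x|circle. p (frac (x - s)) * E x) = integral {0..1} (\<lambda>z. p z * E (z + s))"
  using per by (intro circle_integral_comoving[of "\<lambda>y x. p y * E x"] continuous_on_mult_shift p E)
    (simp add: period_one_def)

text \<open>
  In the frame of the wave the integrand is the derivative of \<open>p \<cdot> \<psi>\<close> on one period. The condition
  \<open>p 0 = p 1\<close> makes the boundary terms cancel. The values \<open>q 0\<close> and \<open>q 1\<close> may differ, so a corner at the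
  crest is harmless.
\<close>

lemma wave_integral_by_parts:
  assumes p: "\<And>y. (p has_real_derivative q y) (at y)"
    and q: "continuous_on UNIV q" and ends: "p 0 = p 1"
    and per: "period_one \<psi>" and \<psi>: "\<And>x. (\<psi> has_real_derivative \<psi>' x) (at x)"
    and \<psi>': "continuous_on UNIV \<psi>'"
  shows "(LINT x|circle. p (frac (x - s)) * \<psi>' x + q (frac (x - s)) * \<psi> x) = 0"
proof -
  have per': "period_one \<psi>'" by (rule period_one_derivative[OF per \<psi>])
  have cp: "continuous_on UNIV p" and c\<psi>: "continuous_on UNIV \<psi>"
    by (intro continuous_at_imp_continuous_on ballI DERIV_isCont[OF p] DERIV_isCont[OF \<psi>])+
  have "(LINT x|circle. p (frac (x - s)) * \<psi>' x + q (frac (x - s)) * \<psi> x)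
      = integral {0..1} (\<lambda>z. p z * \<psi>' (z + s) + q z * \<psi> (z + s))"
    using per per'
    by (intro circle_integral_comoving[of "\<lambda>y x. p y * \<psi>' x + q y * \<psi> x"]
        continuous_on_add continuous_on_mult_shift cp q c\<psi> \<psi>') (simp add: period_one_def)
  also have "\<dots> = p 1 * \<psi> (1 + s) - p 0 * \<psi> (0 + s)"
  proof (rule integral_unique, rule fundamental_theorem_of_calculus)
    fix x :: real
    have "((\<lambda>x. \<psi> (x + s)) has_real_derivative \<psi>' (x + s)) (at x)"
      using \<psi>[of "x + s"] by (simp add: DERIV_shift)
    from DERIV_mult[OF p this]
    have "((\<lambda>x. p x * \<psi> (x + s)) has_real_derivative p x * \<psi>' (x + s) + q x * \<psi> (x + s)) (at x)"
      by (simp add: algebra_simps)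
    then show "((\<lambda>x. p x * \<psi> (x + s)) has_vector_derivative p x * \<psi>' (x + s) + q x * \<psi> (x + s))
        (at x within {0..1})"
      by (simp add: has_real_derivative_iff_has_vector_derivative has_vector_derivative_at_within)
  qed simp
  also have "\<dots> = 0" using ends per by (simp add: period_one_def add.commute[of 1])
  finally show ?thesis .
qed

lemma has_weak_deriv_wave:
  assumes p: "\<And>y. (p has_real_derivative q y) (at y)"
    and q: "continuous_on UNIV q" and ends: "p 0 = p 1"
  shows "has_weak_deriv (\<lambda>x. p (frac (x - s))) (\<lambda>x. q (frac (x - s)))"
  unfolding has_weak_deriv_def
proof (intro conjI allI impI period_one_wave)
  have cp: "continuous_on UNIV p"
    by (intro continuous_at_imp_continuous_on ballI DERIV_isCont[OF p])
  show ip: "integrable circle (\<lambda>x. p (frac (x - s)))" and iq: "integrable circle (\<lambda>x. q (frac (x - s)))"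
    by (intro integrable_circle_wave cp q)+
  fix \<psi> assume \<psi>: "smooth_periodic \<psi>"
  then have "(LINT x|circle. p (frac (x - s)) * deriv \<psi> x + q (frac (x - s)) * \<psi> x) = 0"
    by (intro wave_integral_by_parts p ends q smooth_periodic_DERIV
        smooth_periodic_continuous_deriv) (auto simp: smooth_periodic_def)
  then show "(LINT x|circle. p (frac (x - s)) * deriv \<psi> x) = - (LINT x|circle. q (frac (x - s)) * \<psi> x)"
    using integrable_circle_mult_continuous[OF ip smooth_periodic_continuous_deriv[OF \<psi>]]
      integrable_circle_mult_continuous[OF iq smooth_periodic_continuous[OF \<psi>]]
    by simp
qed


section \<open>Travelling waves in the Sobolev space\<close>

lemma W13_norm_eq:
  assumes f: "has_weak_deriv f g"
  shows "W13_norm f = (LINT x|circle. \<bar>f x\<bar> ^ 3 + \<bar>g x\<bar> ^ 3) powr (1/3)"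
proof -
  have [measurable]: "f \<in> borel_measurable circle" "g \<in> borel_measurable circle"
    "weak_deriv f \<in> borel_measurable circle"
    using f AE_weak_deriv(2)[OF f] by (auto simp: has_weak_deriv_def)
  have "(LINT x|circle. \<bar>f x\<bar> ^ 3 + \<bar>weak_deriv f x\<bar> ^ 3) = (LINT x|circle. \<bar>f x\<bar> ^ 3 + \<bar>g x\<bar> ^ 3)"
    by (rule integral_cong_AE) (use AE_weak_deriv(1)[OF f] in auto)
  then show ?thesis by (simp add: W13_norm_def)
qed

lemma wave_in_L3:
  assumes "continuous_on UNIV p"
  shows "(\<lambda>x. p (frac (x - s))) \<in> L3"
proof -
  have "integrable circle (\<lambda>x. \<bar>p (frac (x - s))\<bar> ^ 3)"
    by (rule integrable_circle_wave[of "\<lambda>y. \<bar>p y\<bar> ^ 3"]) (intro continuous_intros assms)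
  then show ?thesis
    by (auto simp: L3_def intro: borel_measurable_circleI wave_measurable assms)
qed

text \<open>
  Profiles whose periodic extension is continuous, possibly with one corner per period; a jump
  would put an atom into the distributional derivative of the translates.
\<close>

locale periodic_profile =
  fixes p q :: "real \<Rightarrow> real"
  assumes deriv: "\<And>y. (p has_real_derivative q y) (at y)"
    and continuous_deriv: "continuous_on UNIV q"
    and ends: "p 0 = p 1"
begin

lemma continuous: "continuous_on UNIV p"
  by (intro continuous_at_imp_continuous_on ballI DERIV_isCont[OF deriv])

abbreviation wave :: "real \<Rightarrow> real \<Rightarrow> real"
  where "wave s \<equiv> \<lambda>x. p (frac (x - s))"

lemma weak_deriv: "has_weak_deriv (wave s) (\<lambda>x. q (frac (x - s)))"
  by (rule has_weak_deriv_wave[OF deriv continuous_deriv ends])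

lemma wave_in_W13: "wave s \<in> W13"
  using weak_deriv wave_in_L3[OF continuous] wave_in_L3[OF continuous_deriv]
  by (auto simp: W13_def period_one_wave)

lemma W13_norm_wave: "W13_norm (wave s) = W13_norm (wave 0)"
proof -
  have "integrable circle (\<lambda>x. \<bar>p (frac (x - 0))\<bar> ^ 3 + \<bar>q (frac (x - 0))\<bar> ^ 3)"
    by (rule integrable_circle_wave[of "\<lambda>y. \<bar>p y\<bar> ^ 3 + \<bar>q y\<bar> ^ 3"])
      (intro continuous_intros continuous continuous_deriv)
  moreover have "period_one (\<lambda>x. \<bar>p (frac (x - 0))\<bar> ^ 3 + \<bar>q (frac (x - 0))\<bar> ^ 3)"
    by (rule period_one_wave[of "\<lambda>y. \<bar>p y\<bar> ^ 3 + \<bar>q y\<bar> ^ 3"])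
  ultimately show ?thesis
    using circle_integral_shift[of "\<lambda>x. \<bar>p (frac (x - 0))\<bar> ^ 3 + \<bar>q (frac (x - 0))\<bar> ^ 3" s]
    unfolding W13_norm_eq[OF weak_deriv] by simp
qed

text \<open>
  Away from the translates of the integers the extended profile and its derivative are continuous,
  so their differences tend to zero pointwise almost everywhere; they are bounded, and dominated
  convergence applies.
\<close>

lemma tendsto_W13_norm_translate:
  assumes r: "r \<longlonglongrightarrow> s"
  shows "(\<lambda>n. W13_norm (\<lambda>x. wave (r n) x - wave s x)) \<longlonglongrightarrow> 0"
proof -
  have pt: "(\<lambda>n. f (frac (x - r n))) \<longlonglongrightarrow> f (frac (x - s))"
    if f: "continuous_on UNIV f" and x: "x - s \<notin> \<int>" for f :: "real \<Rightarrow> real" and x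
  proof -
    have xr: "(\<lambda>n. x - r n) \<longlonglongrightarrow> x - s" by (intro tendsto_intros r)
    have "(\<lambda>n. frac (x - r n)) \<longlonglongrightarrow> frac (x - s)"
      unfolding frac_def by (intro tendsto_diff tendsto_of_int_floor xr x)
    with f show ?thesis by (rule continuous_on_tendsto_compose) auto
  qed
  let ?d = "\<lambda>n x. \<bar>wave (r n) x - wave s x\<bar> ^ 3 + \<bar>q (frac (x - r n)) - q (frac (x - s))\<bar> ^ 3"
  obtain A where A: "\<And>x. \<bar>p (frac x)\<bar> \<le> A" using wave_bounded[OF continuous] by blast
  obtain B where B: "\<And>x. \<bar>q (frac x)\<bar> \<le> B" using wave_bounded[OF continuous_deriv] by blast
  have [measurable]: "(\<lambda>x. p (frac (x - t))) \<in> borel_measurable circle"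
    "(\<lambda>x. q (frac (x - t))) \<in> borel_measurable circle" for t
    by (intro borel_measurable_circleI wave_measurable continuous continuous_deriv)+
  have "(\<lambda>n. LINT x|circle. ?d n x) \<longlonglongrightarrow> (LINT x|circle. 0)"
  proof (rule integral_dominated_convergence[where w = "\<lambda>_. (A + A) ^ 3 + (B + B) ^ 3"])
    have "countable (range (\<lambda>k::int. of_int k + s))" by simp
    from AE_circle_avoid_countable[OF this]
    show "AE x in circle. (\<lambda>n. ?d n x) \<longlonglongrightarrow> 0"
    proof eventually_elim
      case (elim x)
      then have x: "x - s \<notin> \<int>" by (auto elim!: Ints_cases simp: algebra_simps)
      have "(\<lambda>n. ?d n x) \<longlonglongrightarrow> \<bar>wave s x - wave s x\<bar> ^ 3 + \<bar>q (frac (x - s)) - q (frac (x - s))\<bar> ^ 3"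
        by (intro tendsto_intros pt x continuous continuous_deriv)
      then show ?case by simp
    qed
    show "AE x in circle. norm (?d n x) \<le> (A + A) ^ 3 + (B + B) ^ 3" for n
    proof (rule AE_I2)
      fix x
      have "\<bar>wave (r n) x - wave s x\<bar> \<le> A + A" "\<bar>q (frac (x - r n)) - q (frac (x - s))\<bar> \<le> B + B"
        using A[of "x - r n"] A[of "x - s"] B[of "x - r n"] B[of "x - s"] by linarith+
      then have "?d n x \<le> (A + A) ^ 3 + (B + B) ^ 3" by (intro add_mono power_mono) auto
      then show "norm (?d n x) \<le> (A + A) ^ 3 + (B + B) ^ 3" by simp
    qed
    show "integrable circle (\<lambda>_. (A + A) ^ 3 + (B + B) ^ 3)"
      by (intro finite_measure.integrable_const finite_measure_circle)
  qed simp_all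
  then have "(\<lambda>n. (LINT x|circle. ?d n x) powr (1/3)) \<longlonglongrightarrow> 0"
    by (intro tendsto_zero_powrI[where b = "1/3"] tendsto_const) auto
  then show ?thesis
    by (simp add: W13_norm_eq[OF has_weak_deriv_diff[OF weak_deriv weak_deriv]])
qed

text \<open>
  The approximating simple functions freeze the wave on time steps of length \<open>1/(n+1)\<close>.
\<close>

lemma travelling_wave_measurable: "W13_measurable T (\<lambda>t. wave (c * t))"
proof -
  define tn where "tn n t = real_of_int \<lfloor>real (Suc n) * t\<rfloor> / real (Suc n)" for n t
  have lim: "(\<lambda>n. c * tn n t) \<longlonglongrightarrow> c * t" for t
  proof -
    have "(\<lambda>n. tn n t - t) \<longlonglongrightarrow> 0"
    proof (rule Lim_null_comparison)
      show "\<forall>\<^sub>F n in sequentially. norm (tn n t - t) \<le> 1 / real (Suc n)"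
      proof (rule always_eventually, rule allI)
        fix n
        have "tn n t - t = (real_of_int \<lfloor>real (Suc n) * t\<rfloor> - real (Suc n) * t) / real (Suc n)"
          by (simp add: tn_def diff_divide_distrib)
        moreover have "\<bar>real_of_int \<lfloor>real (Suc n) * t\<rfloor> - real (Suc n) * t\<bar> \<le> 1" by linarith
        ultimately show "norm (tn n t - t) \<le> 1 / real (Suc n)"
          by (simp add: divide_right_mono)
      qed
      show "(\<lambda>n. 1 / real (Suc n)) \<longlonglongrightarrow> 0" by (rule lim_inverse_n'[THEN LIMSEQ_Suc])
    qed
    then show ?thesis by (intro tendsto_mult tendsto_const) (simp add: Lim_null[symmetric])
  qed
  have simple: "simple_function (lebesgue_on {0..<T}) (\<lambda>t. wave (c * tn n t))" for n
  proof -
    have "simple_function (lebesgue_on {0..<T}) (\<lambda>t. \<lfloor>real (Suc n) * t\<rfloor>)"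
      unfolding simple_function_eq_measurable
    proof
      have "(\<lambda>t. \<lfloor>real (Suc n) * t\<rfloor>) ` {0..<T} \<subseteq> {0..\<lfloor>real (Suc n) * T\<rfloor>}"
        by (auto intro!: floor_mono mult_left_mono)
      then show "finite ((\<lambda>t. \<lfloor>real (Suc n) * t\<rfloor>) ` space (lebesgue_on {0..<T}))"
        using finite_subset by auto
      have "(\<lambda>t. real (Suc n) * t) \<in> borel_measurable (lebesgue_on {0..<T})"
        by (intro measurable_restrict_space1 measurable_completion) simp
      then show "(\<lambda>t. \<lfloor>real (Suc n) * t\<rfloor>) \<in> measurable (lebesgue_on {0..<T}) (count_space UNIV)"
        by (rule measurable_compose) simp
    qed
    from simple_function_compose[OF this, of "\<lambda>k. wave (c * (real_of_int k / real (Suc n)))"]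
    show ?thesis by (simp add: tn_def o_def)
  qed
  show ?thesis
    unfolding W13_measurable_def
    by (rule exI[of _ "\<lambda>n t. wave (c * tn n t)"])
      (use simple wave_in_W13 tendsto_W13_norm_translate[OF lim] in auto)
qed

lemma travelling_wave_Linf_loc_W13: "(\<lambda>t. wave (c * t)) \<in> Linf_loc_W13 T"
  unfolding Linf_loc_W13_def
  using wave_in_W13 travelling_wave_measurable W13_norm_wave by (auto intro!: exI[of _ "W13_norm (wave 0)"])

end


section \<open>Convolution with the periodic Green function\<close>

lemma green_measurable: "green \<in> borel_measurable borel"
proof -
  have "continuous_on UNIV (\<lambda>y::real. 1 / (2 * sinh (1/2)) * cosh (y - 1/2))"
    by (intro continuous_intros) auto
  from wave_measurable[OF this, of 0] show ?thesis by (simp add: green_def[abs_def])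
qed

lemma green_bounded: "\<bar>green x\<bar> \<le> cosh (1/2) / (2 * sinh (1/2))"
proof -
  have "\<bar>frac x - 1/2\<bar> \<le> 1/2"
    unfolding abs_le_iff using frac_ge_0[of x] frac_lt_1[of x] by linarith
  then have "cosh \<bar>frac x - 1/2\<bar> \<le> cosh (1/2)" by (subst cosh_real_nonneg_le_iff) auto
  then show ?thesis by (simp add: green_def abs_mult divide_right_mono)
qed

lemma period_one_green: "period_one green"
  using period_one_wave[of "\<lambda>y. 1 / (2 * sinh (1/2)) * cosh (y - 1/2)" 0]
  by (simp add: green_def[abs_def])

text \<open>
  Variation of constants: on each of the intervals \<open>y < x\<close> and \<open>y > x\<close> the Green function is a
  hyperbolic cosine, and the integrand has an antiderivative built from \<open>w\<close> and \<open>w'\<close>. Periodicity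
  of \<open>w\<close> and \<open>w'\<close> cancels the terms at the end points, and the jump of the derivative of the Green
  function at \<open>y = x\<close> produces \<open>w x\<close>.
\<close>

lemma green_has_integral:
  fixes w w' w'' :: "real \<Rightarrow> real"
  assumes w: "\<And>y. (w has_real_derivative w' y) (at y)" and w': "\<And>y. (w' has_real_derivative w'' y) (at y)"
    and ends: "w 0 = w 1" "w' 0 = w' 1" and x: "x \<in> {0..<1}"
  shows "((\<lambda>y. green (x - y) * (w y - w'' y)) has_integral w x) {0..1}"
proof -
  define k :: real where "k = 1 / (2 * sinh (1/2))"
  have k: "2 * k * sinh (1/2) = 1" by (simp add: k_def)
  \<comment> \<open>\<open>b = -1/2\<close> for \<open>y < x\<close> and \<open>b = 1/2\<close> for \<open>y > x\<close>, where \<open>frac (x - y) = x - y + 1\<close>\<close>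
  define E where "E b y = - k * (cosh (x - y + b) * w' y + sinh (x - y + b) * w y)" for b y
  have E: "((\<lambda>y. k * cosh (x - y + b) * (w y - w'' y)) has_integral E b v - E b u) {u..v}" if "u \<le> v" for b u v
  proof (rule fundamental_theorem_of_calculus[OF that])
    fix y
    have "(E b has_real_derivative k * cosh (x - y + b) * (w y - w'' y)) (at y)"
      unfolding E_def
      by (rule derivative_eq_intros w w' refl)+ (simp add: algebra_simps)
    then show "(E b has_vector_derivative k * cosh (x - y + b) * (w y - w'' y)) (at y within {u..v})"
      by (simp add: has_real_derivative_iff_has_vector_derivative has_vector_derivative_at_within)
  qed
  have "((\<lambda>y. green (x - y) * (w y - w'' y)) has_integral E (-1/2) x - E (-1/2) 0) {0..x}"
  proof (rule has_integral_spike_finite[of "{0, x, 1}"])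
    show "((\<lambda>y. k * cosh (x - y + (-1/2)) * (w y - w'' y)) has_integral E (-1/2) x - E (-1/2) 0) {0..x}"
      using E[of 0 x "-1/2"] x by simp
    fix y assume y: "y \<in> {0..x} - {0, x, 1}"
    then have "frac (x - y) = x - y" using x y by (simp add: frac_eq)
    then show "green (x - y) * (w y - w'' y) = k * cosh (x - y + (-1/2)) * (w y - w'' y)"
      by (simp add: green_def k_def)
  qed simp
  moreover have "((\<lambda>y. green (x - y) * (w y - w'' y)) has_integral E (1/2) 1 - E (1/2) x) {x..1}"
  proof (rule has_integral_spike_finite[of "{0, x, 1}"])
    show "((\<lambda>y. k * cosh (x - y + 1/2) * (w y - w'' y)) has_integral E (1/2) 1 - E (1/2) x) {x..1}"
      using E[of x 1 "1/2"] x by simp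
    fix y assume y: "y \<in> {x..1} - {0, x, 1}"
    then have "frac (x - y + 1) = x - y + 1" using x y by (simp add: frac_eq)
    then have "frac (x - y) - 1/2 = x - y + 1/2" by (simp add: frac_1_eq)
    then show "green (x - y) * (w y - w'' y) = k * cosh (x - y + 1/2) * (w y - w'' y)"
      by (simp only: green_def k_def)
  qed simp
  ultimately have "((\<lambda>y. green (x - y) * (w y - w'' y)) has_integral
      (E (-1/2) x - E (-1/2) 0) + (E (1/2) 1 - E (1/2) x)) {0..1}"
    using x by (intro has_integral_combine[of 0 x 1]) auto
  moreover have "E (1/2) 1 = E (-1/2) 0" by (simp add: E_def ends)
  moreover have "E (-1/2) x - E (1/2) x = (2 * k * sinh (1/2)) * w x"
    by (simp add: E_def algebra_simps)
  ultimately show ?thesis by (simp add: k)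
qed

text \<open>
  Any \<open>C\<^sup>1\<close> periodic solution of \<open>w - w'' = f\<close> is the convolution, so a convolution can be found by
  guessing a solution. Translation invariance reduces this to the unshifted wave.
\<close>

lemma circle_conv_green_wave:
  fixes w w' w'' :: "real \<Rightarrow> real"
  assumes w: "\<And>y. (w has_real_derivative w' y) (at y)" and w': "\<And>y. (w' has_real_derivative w'' y) (at y)"
    and ends: "w 0 = w 1" "w' 0 = w' 1"
    and f: "continuous_on UNIV f" "\<And>y. f y = w y - w'' y"
  shows "circle_conv green (\<lambda>y. f (frac (y - s))) x = w (frac (x - s))"
proof -
  define \<xi> where "\<xi> = frac (x - s)"
  have \<xi>: "\<xi> \<in> {0..<1}" by (simp add: \<xi>_def frac_lt_1)
  define h where "h z = green (x - s - z) * f (frac z)" for z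
  have h\<xi>: "h z = green (\<xi> - z) * f (frac z)" for z
    using period_one_add_int[OF period_one_green, of "x - s - z" "- \<lfloor>x - s\<rfloor>"]
    by (simp add: h_def \<xi>_def frac_def algebra_simps)
  have perh: "period_one h"
  proof -
    have "green (x - s - (z + 1)) = green (x - s - z)" for z
      using period_one_add_int[OF period_one_green, of "x - s - z" "-1"] by (simp add: algebra_simps)
    then show ?thesis by (simp add: period_one_def h_def frac_1_eq)
  qed
  have inth: "integrable circle h"
  proof -
    have [measurable]: "green \<in> borel_measurable borel" by (rule green_measurable)
    have [measurable]: "(\<lambda>z. f (frac z)) \<in> borel_measurable borel"
      using wave_measurable[OF f(1), of 0] by simp
    obtain B where B: "\<And>x. \<bar>f (frac x)\<bar> \<le> B" using wave_bounded[OF f(1)] by blast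
    have "B \<ge> 0" using B[of 0] by linarith
    show ?thesis
    proof (rule integrable_circle_bounded)
      show "h \<in> borel_measurable circle" unfolding h_def by (rule borel_measurable_circleI) measurable
      show "\<bar>h z\<bar> \<le> cosh (1/2) / (2 * sinh (1/2)) * B" for z
        unfolding h_def abs_mult using green_bounded B by (intro mult_mono) auto
    qed
  qed
  have "circle_conv green (\<lambda>y. f (frac (y - s))) x = (LINT y|circle. h (y - s))"
    by (simp add: circle_conv_def h_def)
  also have "\<dots> = (LINT y|circle. h y)" by (rule circle_integral_shift[OF perh inth])
  also have "\<dots> = integral {0..<1} h" using inth by (rule lebesgue_integral_eq_integral) simp
  also have "\<dots> = integral {0..<1} (\<lambda>y. green (\<xi> - y) * (w y - w'' y))"
    by (rule Henstock_Kurzweil_Integration.integral_cong) (simp add: h\<xi> frac_eq[THEN iffD2] f(2))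
  also have "\<dots> = integral {0..1} (\<lambda>y. green (\<xi> - y) * (w y - w'' y))"
    by (rule integral_spike_set; rule negligible_subset[of "{1}"]) auto
  also have "\<dots> = w \<xi>"
    using green_has_integral[OF w w' ends \<xi>] by (rule integral_unique)
  finally show ?thesis by (simp add: \<xi>_def)
qed

lemma cosh_square: "cosh b ^ 2 = 1 + sinh b ^ 2" for b :: real
  using cosh_square_eq[of b] by simp

text \<open>
  The three functions below solve \<open>w - w'' = f\<close> on \<open>[-1/2,1/2]\<close> with periodic boundary conditions, for
  \<open>f\<close> equal to \<open>sinh\<^sup>3 b\<close>, \<open>2 cosh\<^sup>3 b + 3 cosh b sinh\<^sup>2 b\<close> and \<open>cosh\<^sup>2 b + sinh\<^sup>2 b / 2\<close>. In each, the last
  summand solves the homogeneous equation, and its coefficient is determined by periodicity: the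
  odd solution has to vanish at \<open>b = 1/2\<close>, and so does the derivative of the even ones.
\<close>

definition green_sinh_cubed :: "real \<Rightarrow> real"
  where "green_sinh_cubed b = - (1/8) * sinh b ^ 3 + 3/8 * b * cosh b
    + (sinh (1/2) ^ 2 / 8 - 3/16 * cosh (1/2) / sinh (1/2)) * sinh b"

definition green_cosh_cubic :: "real \<Rightarrow> real"
  where "green_cosh_cubic b = - (5/8) * cosh b ^ 3 - 3/8 * b * sinh b
    + (15/8 * cosh (1/2) ^ 2 + 3/8 + 3/16 * cosh (1/2) / sinh (1/2)) * cosh b"

definition green_cosh_quadratic :: "real \<Rightarrow> real"
  where "green_cosh_quadratic b = - (1/2) * cosh b ^ 2 + 1/2 + cosh (1/2) * cosh b"

lemma circle_conv_green_sinh_cubed: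
  "circle_conv green (\<lambda>y. K * sinh (frac (y - s) - 1/2) ^ 3) x
     = K * green_sinh_cubed (frac (x - s) - 1/2)"
proof -
  define B :: real where "B = sinh (1/2) ^ 2 / 8 - 3/16 * cosh (1/2) / sinh (1/2)"
  let ?C = "\<lambda>y. cosh (y - 1/2 :: real)" and ?S = "\<lambda>y. sinh (y - 1/2 :: real)"
  let ?w = "\<lambda>y. K * green_sinh_cubed (y - 1/2)"
  let ?w' = "\<lambda>y. K * (- (3/8) * ?S y ^ 2 * ?C y + 3/8 * (?C y + (y - 1/2) * ?S y) + B * ?C y)"
  let ?w'' = "\<lambda>y. K * (- (3/8) * (2 * ?S y * ?C y ^ 2 + ?S y ^ 3) + 3/8 * (2 * ?S y + (y - 1/2) * ?C y) + B * ?S y)"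
  have "circle_conv green (\<lambda>y. (\<lambda>z. K * ?S z ^ 3) (frac (y - s))) x = ?w (frac (x - s))"
  proof (rule circle_conv_green_wave)
    show "(?w has_real_derivative ?w' y) (at y)" for y
      unfolding green_sinh_cubed_def B_def[symmetric]
      by (rule derivative_eq_intros refl)+ (simp add: field_simps power2_eq_square)
    show "(?w' has_real_derivative ?w'' y) (at y)" for y
      by (rule derivative_eq_intros refl)+ (simp add: algebra_simps power2_eq_square power3_eq_cube)
    show "?w 0 = ?w 1"
      by (simp add: green_sinh_cubed_def field_simps power2_eq_square power3_eq_cube)
    show "?w' 0 = ?w' 1" by simp
    show "continuous_on UNIV (\<lambda>z. K * ?S z ^ 3)" by (intro continuous_intros)
    show "K * ?S y ^ 3 = ?w y - ?w'' y" for y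
      unfolding green_sinh_cubed_def B_def[symmetric] cosh_square
      by (simp add: field_simps power2_eq_square power3_eq_cube)
  qed
  then show ?thesis by simp
qed

text \<open>
  The right-hand side is the combination of \<open>u\<^sup>3\<close>, \<open>u u\<^sub>x\<^sup>2\<close>, \<open>u\<^sup>2\<close> and \<open>u\<^sub>x\<^sup>2\<close> of the weak formulation:
  the coefficients of the first two are in the ratio \<open>2 : 3\<close>, those of the last two in the ratio
  \<open>1 : 1/2\<close>.
\<close>

lemma circle_conv_green_cosh:
  "circle_conv green (\<lambda>y. K * (2 * cosh (frac (y - s) - 1/2) ^ 3
        + 3 * cosh (frac (y - s) - 1/2) * sinh (frac (y - s) - 1/2) ^ 2)
      + L * (cosh (frac (y - s) - 1/2) ^ 2 + sinh (frac (y - s) - 1/2) ^ 2 / 2)) x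
   = K * green_cosh_cubic (frac (x - s) - 1/2) + L * green_cosh_quadratic (frac (x - s) - 1/2)"
proof -
  define A :: real where "A = 15/8 * cosh (1/2) ^ 2 + 3/8 + 3/16 * cosh (1/2) / sinh (1/2)"
  let ?C = "\<lambda>y. cosh (y - 1/2 :: real)" and ?S = "\<lambda>y. sinh (y - 1/2 :: real)"
  let ?f = "\<lambda>z. K * (2 * ?C z ^ 3 + 3 * ?C z * ?S z ^ 2) + L * (?C z ^ 2 + ?S z ^ 2 / 2)"
  let ?w = "\<lambda>y. K * green_cosh_cubic (y - 1/2) + L * green_cosh_quadratic (y - 1/2)"
  let ?w' = "\<lambda>y. K * (- (15/8) * ?C y ^ 2 * ?S y - 3/8 * (?S y + (y - 1/2) * ?C y) + A * ?S y)
    + L * (- (?C y * ?S y) + cosh (1/2) * ?S y)"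
  let ?w'' = "\<lambda>y. K * (- (15/8) * (2 * ?C y * ?S y ^ 2 + ?C y ^ 3) - 3/8 * (2 * ?C y + (y - 1/2) * ?S y) + A * ?C y)
    + L * (- (?C y ^ 2 + ?S y ^ 2) + cosh (1/2) * ?C y)"
  have C3: "?C y ^ 3 = ?C y * (1 + ?S y ^ 2)" for y
    by (simp add: power3_eq_cube power2_eq_square[symmetric] mult.assoc cosh_square)
  have "circle_conv green (\<lambda>y. ?f (frac (y - s))) x = ?w (frac (x - s))"
  proof (rule circle_conv_green_wave)
    show "(?w has_real_derivative ?w' y) (at y)" for y
      unfolding green_cosh_cubic_def green_cosh_quadratic_def A_def[symmetric]
      by (rule derivative_eq_intros refl)+ (simp add: field_simps power2_eq_square)
    show "(?w' has_real_derivative ?w'' y) (at y)" for y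
      by (rule derivative_eq_intros refl)+ (simp add: algebra_simps power2_eq_square power3_eq_cube)
    show "?w 0 = ?w 1" by (simp add: green_cosh_cubic_def green_cosh_quadratic_def)
    have "- (15/8) * cosh (1/2) ^ 2 * sinh (1/2) - 3/8 * (sinh (1/2) + 1/2 * cosh (1/2)) + A * sinh (1/2) = (0::real)"
      by (simp add: A_def field_simps)
    then show "?w' 0 = ?w' 1" by (simp add: algebra_simps)
    show "continuous_on UNIV ?f" by (intro continuous_intros) auto
    show "?f y = ?w y - ?w'' y" for y
      unfolding green_cosh_cubic_def green_cosh_quadratic_def A_def[symmetric]
      unfolding C3 cosh_square by (simp add: field_simps power2_eq_square)
  qed
  then show ?thesis by simp
qed


section \<open>Transport of a profile\<close>

text \<open>
  Along the characteristics \<open>x = z + c t\<close> the integrand is \<open>p z\<close> times the total time derivative of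
  \<open>\<phi> t (z + c t)\<close>. Differentiation under the integral sign shows that the left-hand side is the
  integral of the derivative of \<open>t \<mapsto> \<integral> p z \<cdot> \<phi> t (z + c t) dz\<close>, which vanishes near \<open>T\<close>; only the
  value at \<open>t = 0\<close> is left.
\<close>

lemma transport_integral:
  fixes \<phi> \<phi>t \<phi>x :: "real \<Rightarrow> real \<Rightarrow> real"
  assumes p: "continuous_on UNIV p" and T: "0 < T"
    and dt: "\<And>t x. t \<in> {0..<T} \<Longrightarrow> ((\<lambda>s. \<phi> s x) has_real_derivative \<phi>t t x) (at t within {0..<T})"
    and dx: "\<And>t x. t \<in> {0..<T} \<Longrightarrow> (\<phi> t has_real_derivative \<phi>x t x) (at x)"
    and ct: "continuous_on ({0..<T} \<times> UNIV) (\<lambda>(t, x). \<phi>t t x)"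
    and cx: "continuous_on ({0..<T} \<times> UNIV) (\<lambda>(t, x). \<phi>x t x)"
    and supp: "T' < T" "\<And>t x. t \<in> {0..<T} \<Longrightarrow> T' < t \<Longrightarrow> \<phi> t x = 0"
  shows "(LINT t|lebesgue_on {0..<T}. integral {0..1} (\<lambda>z. p z * (\<phi>t t (z + c * t) + c * \<phi>x t (z + c * t))))
    = - integral {0..1} (\<lambda>z. p z * \<phi> 0 z)"
proof -
  define D where "D t z = p z * (\<phi>t t (z + c * t) + c * \<phi>x t (z + c * t))" for t z
  define K where "K t = integral {0..1} (D t)" for t
  define M where "M t = integral {0..1} (\<lambda>z. p z * \<phi> t (z + c * t))" for t
  have D: "((\<lambda>s. p z * \<phi> s (z + c * s)) has_real_derivative D t z) (at t within {0..<T})"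
    if t: "t \<in> {0..<T}" for t z
  proof -
    have "((\<lambda>(s, x). \<phi> s x) has_derivative (\<lambda>(h, k). \<phi>t t (z + c * t) * h + blinfun_mult_right (\<phi>x t (z + c * t)) k))
        (at (t, z + c * t) within {0..<T} \<times> UNIV)"
    proof (rule has_derivative_partialsI)
      show "((\<lambda>s. \<phi> s (z + c * t)) has_derivative (*) (\<phi>t t (z + c * t))) (at t within {0..<T})"
        using dt[OF t] by (simp add: has_field_derivative_def)
      show "(\<phi> s has_derivative blinfun_apply (blinfun_mult_right (\<phi>x s x))) (at x within UNIV)"
        if "s \<in> {0..<T}" for s x
        using dx[OF that, of x] by (simp add: has_field_derivative_def)
      have "continuous_on ({0..<T} \<times> UNIV) (\<lambda>y. blinfun_mult_right (case y of (s, x) \<Rightarrow> \<phi>x s x))"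
        by (intro bounded_linear.continuous_on[OF bounded_linear_blinfun_mult_right] cx)
      then show "continuous (at (t, z + c * t) within {0..<T} \<times> UNIV) (\<lambda>(s, x). blinfun_mult_right (\<phi>x s x))"
        using t by (simp add: continuous_on_eq_continuous_within case_prod_unfold)
    qed auto
    then have joint: "((\<lambda>(s, x). \<phi> s x) has_derivative (\<lambda>(h, k). \<phi>t t (z + c * t) * h + \<phi>x t (z + c * t) * k))
        (at (t, z + c * t) within (\<lambda>s. (s, z + c * s)) ` {0..<T})"
      by (rule has_derivative_subset[THEN has_derivative_eq_rhs]) auto
    have "((\<lambda>s. (s, z + c * s)) has_derivative (\<lambda>h. (h, c * h))) (at t within {0..<T})"
      by (auto intro!: derivative_eq_intros)
    from has_derivative_in_compose[OF this joint]
    have "((\<lambda>s. \<phi> s (z + c * s)) has_derivative (\<lambda>h. \<phi>t t (z + c * t) * h + \<phi>x t (z + c * t) * (c * h)))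
        (at t within {0..<T})"
      by simp
    then have "((\<lambda>s. \<phi> s (z + c * s)) has_real_derivative \<phi>t t (z + c * t) + c * \<phi>x t (z + c * t))
        (at t within {0..<T})"
      unfolding has_field_derivative_def by (rule has_derivative_eq_rhs) (auto simp: algebra_simps)
    from DERIV_cmult[OF this, of "p z"] show ?thesis by (simp add: D_def)
  qed
  have contD: "continuous_on ({0..<T} \<times> cbox 0 1) (\<lambda>(t, z). D t z)"
  proof -
    have frame: "continuous_on ({0..<T} \<times> cbox 0 1) (\<lambda>y. (fst y, snd y + c * fst y))"
      by (intro continuous_intros)
    have sub: "(\<lambda>y. (fst y, snd y + c * fst y)) ` ({0..<T} \<times> cbox 0 1) \<subseteq> {0..<T} \<times> UNIV"
      by auto
    have "continuous_on ({0..<T} \<times> cbox 0 1) (\<lambda>y. \<phi>t (fst y) (snd y + c * fst y))"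
      using continuous_on_compose2[OF ct frame sub] by simp
    moreover have "continuous_on ({0..<T} \<times> cbox 0 1) (\<lambda>y. \<phi>x (fst y) (snd y + c * fst y))"
      using continuous_on_compose2[OF cx frame sub] by simp
    moreover have "continuous_on ({0..<T} \<times> cbox 0 1) (\<lambda>y. p (snd y))"
      by (rule continuous_on_compose2[OF p]) (auto intro: continuous_intros)
    ultimately show ?thesis
      unfolding D_def case_prod_unfold by (intro continuous_intros)
  qed
  have M: "(M has_real_derivative K t) (at t within {0..<T})" if t: "t \<in> {0..<T}" for t
    unfolding M_def K_def interval_cbox
  proof (rule leibniz_rule_field_derivative[OF D _ contD t])
    fix s assume s: "s \<in> {0..<T}"
    have \<phi>s: "continuous_on UNIV (\<phi> s)"
      by (intro continuous_at_imp_continuous_on ballI DERIV_isCont[OF dx[OF s]])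
    have "continuous_on (cbox 0 1) (\<lambda>z. p z * \<phi> s (z + c * s))"
      by (rule continuous_on_mult_shift[OF p \<phi>s])
    then show "(\<lambda>z. p z * \<phi> s (z + c * s)) integrable_on cbox 0 1" by (rule integrable_continuous)
  qed auto
  have contK: "continuous_on {0..<T} K"
    unfolding K_def interval_cbox by (rule integral_continuous_on_param[OF contD])
  \<comment> \<open>a time in \<open>(0,T)\<close> from which on the test function is zero, even if \<open>T'\<close> is negative\<close>
  define b where "b = (max T' 0 + T) / 2"
  have b: "T' < b" "0 < b" "b < T" using T supp(1) by (auto simp: b_def max_def)
  have M0: "M t = 0" if "t \<in> {0..<T}" "T' < t" for t
    using supp(2)[OF that] by (simp add: M_def)
  have K0: "K t = 0" if t: "t \<in> {0..<T}" "b < t" for t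
  proof -
    have int: "t \<in> interior {0..<T}" using t b by (auto simp: interior_atLeastLessThan)
    have "(M has_real_derivative K t) (at t)" using M[OF t(1)] at_within_interior[OF int] by simp
    moreover have "(M has_real_derivative 0) (at t)"
    proof (rule has_field_derivative_transform_within_open[where f = "\<lambda>_. 0" and S = "{b<..<T}"])
      show "0 = M s" if "s \<in> {b<..<T}" for s using M0[of s] that b by auto
    qed (use t in auto)
    ultimately show ?thesis by (rule DERIV_unique)
  qed
  have "(LINT t|lebesgue_on {0..<T}. K t) = (LINT t|lebesgue. indicator {0..<T} t *\<^sub>R K t)"
    by (rule integral_restrict_space) simp
  also have "\<dots> = (LINT t|lebesgue. indicator {0..b} t *\<^sub>R K t)"
    by (rule Bochner_Integration.integral_cong) (use K0 b in \<open>auto simp: indicator_def\<close>)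
  also have "\<dots> = (LINT t|lebesgue_on {0..b}. K t)"
    by (rule integral_restrict_space[symmetric]) simp
  also have "\<dots> = integral {0..b} K"
    using b by (intro lebesgue_integral_eq_integral continuous_imp_integrable_real continuous_on_subset[OF contK]) auto
  also have "\<dots> = M b - M 0"
  proof (rule integral_unique, rule fundamental_theorem_of_calculus)
    show "(M has_vector_derivative K t) (at t within {0..b})" if "t \<in> {0..b}" for t
      using M[of t] that b
      by (auto simp: has_real_derivative_iff_has_vector_derivative intro: has_vector_derivative_within_subset)
  qed (use b in auto)
  also have "\<dots> = - integral {0..1} (\<lambda>z. p z * \<phi> 0 z)"
    using M0[of b] b by (simp add: M_def)
  finally show ?thesis by (simp add: K_def D_def[abs_def])
qed


section \<open>The peakon\<close>

lemma peakon_eq_wave: "peakon a c t = (\<lambda>x. a * cosh (frac (x - c * t) - 1/2))"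
proof
  fix x
  have "1/2 - (x - c * t) + of_int \<lfloor>x - c * t\<rfloor> = - (frac (x - c * t) - 1/2)" by (simp add: frac_def)
  then show "peakon a c t x = a * cosh (frac (x - c * t) - 1/2)"
    unfolding peakon_def by (simp only: cosh_minus)
qed

lemma periodic_profile_peakon: "periodic_profile (\<lambda>y. a * cosh (y - 1/2)) (\<lambda>y. a * sinh (y - 1/2))"
proof
  show "((\<lambda>y. a * cosh (y - 1/2)) has_real_derivative a * sinh (y - 1/2)) (at y)" for y
    by (rule derivative_eq_intros refl)+ simp
qed (auto intro!: continuous_intros)

text \<open>
  All terms of the weak formulation multiplied by \<open>\<phi>\<close>, as a function of \<open>b = frac (x - c t) - 1/2\<close>.
\<close>

definition peakon_source :: "real \<Rightarrow> real \<Rightarrow> real \<Rightarrow> real \<Rightarrow> real"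
  where "peakon_source k1 k2 a b =
    k1 / 3 * (a * sinh b) ^ 3 - (k1 / 3 + k2 / 2) * a ^ 3 * green_sinh_cubed b"

text \<open>
  All terms of the weak formulation multiplied by \<open>\<phi>\<^sub>x\<close>, as a function of \<open>b\<close>.
\<close>

definition peakon_flux :: "real \<Rightarrow> real \<Rightarrow> real \<Rightarrow> real \<Rightarrow> real \<Rightarrow> real"
  where "peakon_flux k1 k2 k3 a b =
    (k1 + k2) / 3 * (a * cosh b) ^ 3 + k3 / 2 * (a * cosh b) ^ 2
    + ((k1 / 3 + k2 / 2) * a ^ 3 * green_cosh_cubic b + k3 * a ^ 2 * green_cosh_quadratic b)"

text \<open>
  The travelling wave equation away from the crest. The secular terms of the two cubic convolutions
  cancel, as do the ratios \<open>cosh (1/2) / sinh (1/2)\<close> in their homogeneous parts; after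
  \<open>cosh\<^sup>2 b = 1 + sinh\<^sup>2 b\<close> only multiples of \<open>sinh b\<close> are left, and their coefficients agree exactly for
  this value of \<open>c\<close>.
\<close>

lemma peakon_flux_deriv:
  assumes c: "c = (k1 / 3 + (cosh (1/2))\<^sup>2 * (2 * k1 / 3 + k2)) * a\<^sup>2 + cosh (1/2) * k3 * a"
  shows "((\<lambda>b. peakon_flux k1 k2 k3 a b - c * (a * cosh b)) has_real_derivative peakon_source k1 k2 a b) (at b)"
proof -
  define R :: real where "R = cosh (1/2) / sinh (1/2)"
  define h :: real where "h = cosh (1/2)"
  have A: "15/8 * cosh (1/2) ^ 2 + 3/8 + 3/16 * cosh (1/2) / sinh (1/2) = 15/8 * h ^ 2 + 3/8 + 3/16 * R"
    by (simp add: R_def h_def)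
  have B: "sinh (1/2) ^ 2 / 8 - 3/16 * cosh (1/2) / sinh (1/2) = (h ^ 2 - 1) / 8 - 3/16 * R"
    unfolding h_def R_def using sinh_square_eq[of "1/2::real"] by simp
  have c': "c = (k1 / 3 + h ^ 2 * (2 * k1 / 3 + k2)) * a ^ 2 + h * k3 * a"
    using c by (simp add: h_def)
  define K where "K = k1 / 3 + k2 / 2"
  define L where "L = (k1 + k2) / 3"
  have cubic: "(green_cosh_cubic has_real_derivative - (15/8) * cosh b ^ 2 * sinh b
      - 3/8 * (sinh b + b * cosh b) + (15/8 * h ^ 2 + 3/8 + 3/16 * R) * sinh b) (at b)"
    unfolding green_cosh_cubic_def A
    by (rule derivative_eq_intros refl)+ (simp add: algebra_simps power2_eq_square)
  have quadratic: "(green_cosh_quadratic has_real_derivative - cosh b * sinh b + h * sinh b) (at b)"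
    unfolding green_cosh_quadratic_def h_def
    by (rule derivative_eq_intros refl)+ simp
  have "((\<lambda>b. peakon_flux k1 k2 k3 a b - c * (a * cosh b)) has_real_derivative
      L * (3 * (a * cosh b) ^ 2 * (a * sinh b)) + k3 / 2 * (2 * (a * cosh b) * (a * sinh b))
      + (K * a ^ 3 * (- (15/8) * cosh b ^ 2 * sinh b - 3/8 * (sinh b + b * cosh b)
            + (15/8 * h ^ 2 + 3/8 + 3/16 * R) * sinh b)
          + k3 * a ^ 2 * (- cosh b * sinh b + h * sinh b)) - c * (a * sinh b)) (at b)"
    unfolding peakon_flux_def K_def[symmetric] L_def[symmetric]
    by (rule derivative_eq_intros cubic quadratic refl)+ simp
  also have "L * (3 * (a * cosh b) ^ 2 * (a * sinh b)) + k3 / 2 * (2 * (a * cosh b) * (a * sinh b))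
      + (K * a ^ 3 * (- (15/8) * cosh b ^ 2 * sinh b - 3/8 * (sinh b + b * cosh b)
            + (15/8 * h ^ 2 + 3/8 + 3/16 * R) * sinh b)
          + k3 * a ^ 2 * (- cosh b * sinh b + h * sinh b)) - c * (a * sinh b)
      = peakon_source k1 k2 a b"
    unfolding peakon_source_def green_sinh_cubed_def B c' power_mult_distrib cosh_square[of b] K_def L_def
    by (simp add: field_simps power2_eq_square power3_eq_cube)
  finally show ?thesis .
qed

text \<open>
  At a fixed time the nonlinear terms amount to transport of \<open>u\<close> with speed \<open>c\<close>: the flux in excess
  of \<open>c u\<close> balances the source. The functions \<open>\<psi>\<close>, \<open>\<psi>x\<close> and \<open>\<theta>\<close> stand for \<open>\<phi>\<close>, \<open>\<phi>\<^sub>x\<close> and \<open>\<phi>\<^sub>t\<close>.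
\<close>

lemma peakon_weak_form_slice:
  assumes c: "c = (k1 / 3 + (cosh (1/2))\<^sup>2 * (2 * k1 / 3 + k2)) * a\<^sup>2 + cosh (1/2) * k3 * a"
    and per: "period_one \<psi>" and \<psi>: "\<And>x. (\<psi> has_real_derivative \<psi>x x) (at x)"
    and \<psi>x: "continuous_on UNIV \<psi>x" and \<theta>: "continuous_on UNIV \<theta>"
    and u_def: "u = peakon a c t"
  shows "(LINT x|circle.
      u x * \<theta> x + (k1 + k2) / 3 * u x ^ 3 * \<psi>x x + k1 / 3 * weak_deriv u x ^ 3 * \<psi> x
      + k3 / 2 * u x ^ 2 * \<psi>x x
      - circle_conv green (\<lambda>y. (k1 / 3 + k2 / 2) * weak_deriv u y ^ 3) x * \<psi> x
      + circle_conv green (\<lambda>y. (2 * k1 / 3 + k2) * u y ^ 3 + (k1 + 3 * k2 / 2) * u y * weak_deriv u y ^ 2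
          + k3 * u y ^ 2 + k3 / 2 * weak_deriv u y ^ 2) x * \<psi>x x)
    = (LINT x|circle. u x * (\<theta> x + c * \<psi>x x))"
proof -
  define K where "K = k1 / 3 + k2 / 2"
  define b where "b x = frac (x - c * t) - 1/2" for x
  define v where "v x = a * sinh (b x)" for x
  have u: "u x = a * cosh (b x)" for x by (simp add: u_def b_def peakon_eq_wave)
  have wd: "has_weak_deriv u v"
    using periodic_profile.weak_deriv[OF periodic_profile_peakon, of a "c * t"]
    by (simp add: u_def v_def[abs_def] b_def[abs_def] peakon_eq_wave)
  have AEv: "AE x in circle. weak_deriv u x = v x" by (rule AE_weak_deriv(1)[OF wd])
  have [measurable]: "u \<in> borel_measurable circle" "v \<in> borel_measurable circle"
    "weak_deriv u \<in> borel_measurable circle"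
    using wd AE_weak_deriv(2)[OF wd] by (auto simp: has_weak_deriv_def)
  have [measurable]: "(\<lambda>y. green (x - y)) \<in> borel_measurable circle" for x
    by (intro borel_measurable_circleI measurable_compose[OF _ green_measurable]) simp
  have conv_cong: "circle_conv green f x = circle_conv green g x"
    if [measurable]: "f \<in> borel_measurable circle" "g \<in> borel_measurable circle"
      and "AE y in circle. f y = g y" for f g x
    unfolding circle_conv_def using that(3) by (intro integral_cong_AE) auto
  have conv1: "circle_conv green (\<lambda>y. K * weak_deriv u y ^ 3) x = K * a ^ 3 * green_sinh_cubed (b x)" for x
  proof -
    have "circle_conv green (\<lambda>y. K * weak_deriv u y ^ 3) x
        = circle_conv green (\<lambda>y. K * a ^ 3 * sinh (frac (y - c * t) - 1/2) ^ 3) x"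
    proof (rule conv_cong)
      show "AE y in circle. K * weak_deriv u y ^ 3 = K * a ^ 3 * sinh (frac (y - c * t) - 1/2) ^ 3"
        using AEv by eventually_elim (simp add: v_def b_def power_mult_distrib)
      have "(\<lambda>y. K * v y ^ 3) \<in> borel_measurable circle" by measurable
      then show "(\<lambda>y. K * a ^ 3 * sinh (frac (y - c * t) - 1/2) ^ 3) \<in> borel_measurable circle"
        by (simp add: v_def b_def power_mult_distrib mult.assoc)
    qed measurable
    then show ?thesis by (simp only: circle_conv_green_sinh_cubed b_def)
  qed
  have conv2: "circle_conv green (\<lambda>y. (2 * k1 / 3 + k2) * u y ^ 3 + (k1 + 3 * k2 / 2) * u y * weak_deriv u y ^ 2
          + k3 * u y ^ 2 + k3 / 2 * weak_deriv u y ^ 2) x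
      = K * a ^ 3 * green_cosh_cubic (b x) + k3 * a ^ 2 * green_cosh_quadratic (b x)" for x
  proof -
    let ?g = "\<lambda>y. K * a ^ 3 * (2 * cosh (frac (y - c * t) - 1/2) ^ 3
        + 3 * cosh (frac (y - c * t) - 1/2) * sinh (frac (y - c * t) - 1/2) ^ 2)
      + k3 * a ^ 2 * (cosh (frac (y - c * t) - 1/2) ^ 2 + sinh (frac (y - c * t) - 1/2) ^ 2 / 2)"
    have g: "?g y = (2 * k1 / 3 + k2) * u y ^ 3 + (k1 + 3 * k2 / 2) * u y * v y ^ 2
          + k3 * u y ^ 2 + k3 / 2 * v y ^ 2" for y
      unfolding K_def u v_def b_def by (simp add: field_simps power2_eq_square power3_eq_cube)
    have "circle_conv green (\<lambda>y. (2 * k1 / 3 + k2) * u y ^ 3 + (k1 + 3 * k2 / 2) * u y * weak_deriv u y ^ 2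
          + k3 * u y ^ 2 + k3 / 2 * weak_deriv u y ^ 2) x = circle_conv green ?g x"
    proof (rule conv_cong)
      show "AE y in circle. (2 * k1 / 3 + k2) * u y ^ 3 + (k1 + 3 * k2 / 2) * u y * weak_deriv u y ^ 2
          + k3 * u y ^ 2 + k3 / 2 * weak_deriv u y ^ 2 = ?g y"
        using AEv unfolding g by eventually_elim simp
      show "?g \<in> borel_measurable circle" unfolding g by measurable
    qed measurable
    then show ?thesis by (simp only: circle_conv_green_cosh b_def)
  qed
  \<comment> \<open>The flux is taken relative to the moving frame: the transport of \<open>u\<close> itself is subtracted.\<close>
  define F where "F y = peakon_flux k1 k2 k3 a (y - 1/2) - c * (a * cosh (y - 1/2))" for y
  define H where "H y = peakon_source k1 k2 a (y - 1/2)" for y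
  have F: "(F has_real_derivative H y) (at y)" for y
    using DERIV_shift[of "\<lambda>b. peakon_flux k1 k2 k3 a b - c * (a * cosh b)" "H y" y "- (1/2)"]
      peakon_flux_deriv[OF c, of "y - 1/2"]
    by (simp add: F_def[abs_def] H_def)
  have contF: "continuous_on UNIV F"
    by (intro continuous_at_imp_continuous_on ballI DERIV_isCont[OF F])
  have contH: "continuous_on UNIV H"
    unfolding H_def peakon_source_def green_sinh_cubed_def by (intro continuous_intros) auto
  have ends: "F 0 = F 1"
    by (simp add: F_def peakon_flux_def green_cosh_cubic_def green_cosh_quadratic_def)
  have cont\<psi>: "continuous_on UNIV \<psi>"
    by (intro continuous_at_imp_continuous_on ballI DERIV_isCont[OF \<psi>])
  have [measurable]: "\<psi> \<in> borel_measurable circle" "\<psi>x \<in> borel_measurable circle" "\<theta> \<in> borel_measurable circle"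
    by (intro borel_measurable_circleI borel_measurable_continuous_onI cont\<psi> \<psi>x \<theta>)+
  have int1: "integrable circle (\<lambda>x. u x * (\<theta> x + c * \<psi>x x))"
    using wd by (intro integrable_circle_mult_continuous continuous_intros \<theta> \<psi>x) (simp add: has_weak_deriv_def)
  have intF: "integrable circle (\<lambda>x. F (frac (x - c * t)) * \<psi>x x)"
    and intH: "integrable circle (\<lambda>x. H (frac (x - c * t)) * \<psi> x)"
    by (intro integrable_circle_mult_continuous integrable_circle_wave contF contH cont\<psi> \<psi>x)+
  have [measurable]: "(\<lambda>x. F (frac (x - c * t))) \<in> borel_measurable circle"
      "(\<lambda>x. H (frac (x - c * t))) \<in> borel_measurable circle"
    by (intro borel_measurable_circleI wave_measurable contF contH)+
  have flux: "(LINT x|circle. F (frac (x - c * t)) * \<psi>x x + H (frac (x - c * t)) * \<psi> x) = 0"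
    by (rule wave_integral_by_parts[OF F contH ends per \<psi> \<psi>x])
  have Fu: "F (frac (x - c * t)) = (k1 + k2) / 3 * u x ^ 3 + k3 / 2 * u x ^ 2
      + (K * a ^ 3 * green_cosh_cubic (b x) + k3 * a ^ 2 * green_cosh_quadratic (b x)) - c * u x" for x
    by (simp add: F_def peakon_flux_def u b_def K_def)
  have Hu: "H (frac (x - c * t)) = k1 / 3 * v x ^ 3 - K * a ^ 3 * green_sinh_cubed (b x)" for x
    by (simp add: H_def peakon_source_def v_def b_def K_def)
  \<comment> \<open>Eliminating the convolutions in favour of \<open>F\<close> and \<open>H\<close> leaves an identity linear in these.\<close>
  have Hw: "K * a ^ 3 * green_sinh_cubed (b x) = k1 / 3 * v x ^ 3 - H (frac (x - c * t))" for x
    by (simp add: Hu)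
  have Fw: "K * a ^ 3 * green_cosh_cubic (b x) + k3 * a ^ 2 * green_cosh_quadratic (b x)
      = F (frac (x - c * t)) + c * u x - (k1 + k2) / 3 * u x ^ 3 - k3 / 2 * u x ^ 2" for x
    by (simp add: Fu)
  have "(LINT x|circle.
      u x * \<theta> x + (k1 + k2) / 3 * u x ^ 3 * \<psi>x x + k1 / 3 * weak_deriv u x ^ 3 * \<psi> x
      + k3 / 2 * u x ^ 2 * \<psi>x x
      - circle_conv green (\<lambda>y. K * weak_deriv u y ^ 3) x * \<psi> x
      + circle_conv green (\<lambda>y. (2 * k1 / 3 + k2) * u y ^ 3 + (k1 + 3 * k2 / 2) * u y * weak_deriv u y ^ 2
          + k3 * u y ^ 2 + k3 / 2 * weak_deriv u y ^ 2) x * \<psi>x x)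
    = (LINT x|circle. u x * (\<theta> x + c * \<psi>x x)
        + (F (frac (x - c * t)) * \<psi>x x + H (frac (x - c * t)) * \<psi> x))"
    unfolding conv1 conv2 Hw Fw
  proof (rule integral_cong_AE)
    show "AE x in circle. u x * \<theta> x + (k1 + k2) / 3 * u x ^ 3 * \<psi>x x + k1 / 3 * weak_deriv u x ^ 3 * \<psi> x
      + k3 / 2 * u x ^ 2 * \<psi>x x - (k1 / 3 * v x ^ 3 - H (frac (x - c * t))) * \<psi> x
      + (F (frac (x - c * t)) + c * u x - (k1 + k2) / 3 * u x ^ 3 - k3 / 2 * u x ^ 2) * \<psi>x x
      = u x * (\<theta> x + c * \<psi>x x) + (F (frac (x - c * t)) * \<psi>x x + H (frac (x - c * t)) * \<psi> x)"
      using AEv by eventually_elim (simp add: algebra_simps)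
  qed measurable
  also have "\<dots> = (LINT x|circle. u x * (\<theta> x + c * \<psi>x x))"
    using int1 intF intH flux by simp
  finally show ?thesis by (simp only: K_def)
qed

theorem proposition1p3:
  fixes k1 k2 k3 a c :: real
  assumes "a \<noteq> 0"
    and "c = (k1 / 3 + (cosh (1/2))\<^sup>2 * (2 * k1 / 3 + k2)) * a\<^sup>2 + cosh (1/2) * k3 * a"
  shows "global_weak_solution k1 k2 k3 (peakon a c 0) (peakon a c)"
  unfolding global_weak_solution_def weak_solution_def
proof (intro allI impI conjI)
  fix T :: real assume T: "0 < T"
  define p where "p y = a * cosh (y - 1/2)" for y
  have peakon: "peakon a c t = (\<lambda>x. p (frac (x - c * t)))" for t
    by (simp add: p_def peakon_eq_wave)
  interpret periodic_profile p "\<lambda>y. a * sinh (y - 1/2)"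
    using periodic_profile_peakon[of a] by (simp add: p_def[abs_def])
  show "peakon a c 0 \<in> W13" unfolding peakon by (rule wave_in_W13)
  show "peakon a c \<in> Linf_loc_W13 T"
    using travelling_wave_Linf_loc_W13[of c T] by (simp add: peakon[abs_def])
  fix \<phi> assume \<phi>: "test_function T \<phi>"
  then have per: "period_one (\<phi> t)" if "t \<in> {0..<T}" for t
    using that by (simp add: test_function_def)
  obtain T' where T': "T' < T" "\<And>t x. t \<in> {0..<T} \<Longrightarrow> T' < t \<Longrightarrow> \<phi> t x = 0"
    using \<phi> unfolding test_function_def by blast
  obtain D :: "nat \<Rightarrow> nat \<Rightarrow> real \<Rightarrow> real \<Rightarrow> real" where
    D0: "\<And>t x. t \<in> {0..<T} \<Longrightarrow> D 0 0 t x = \<phi> t x"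
    and Dc: "\<And>i j. continuous_on ({0..<T} \<times> UNIV) (\<lambda>(t, x). D i j t x)"
    and Dt: "\<And>i j t x. t \<in> {0..<T} \<Longrightarrow> ((\<lambda>s. D i j s x) has_real_derivative D (Suc i) j t x) (at t within {0..<T})"
    and Dx: "\<And>i j t x. t \<in> {0..<T} \<Longrightarrow> (D i j t has_real_derivative D i (Suc j) t x) (at x)"
    using \<phi> unfolding test_function_def by blast
  have dx: "(\<phi> t has_real_derivative D 0 1 t x) (at x)" if t: "t \<in> {0..<T}" for t x
  proof -
    have "D 0 0 t = \<phi> t" using D0[OF t] by auto
    then show ?thesis using Dx[OF t, of 0 0 x] by simp
  qed
  have dt: "((\<lambda>s. \<phi> s x) has_real_derivative D 1 0 t x) (at t within {0..<T})" if t: "t \<in> {0..<T}" for t x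
    using has_field_derivative_transform_within[OF Dt[OF t, of 0 0 x] zero_less_one t] D0 by simp
  have cD: "continuous_on UNIV (D i j t)" if t: "t \<in> {0..<T}" for i j t
    by (intro continuous_at_imp_continuous_on ballI DERIV_isCont[OF Dx[OF t]])
  have slice: "(LINT x|circle.
         (let ux = weak_deriv (peakon a c t);
              \<phi>t = deriv (\<lambda>s. \<phi> s x) t;
              \<phi>x = deriv (\<phi> t) x
          in peakon a c t x * \<phi>t
             + (k1 + k2) / 3 * peakon a c t x ^ 3 * \<phi>x
             + k1 / 3 * ux x ^ 3 * \<phi> t x
             + k3 / 2 * peakon a c t x ^ 2 * \<phi>x
             - circle_conv green (\<lambda>y. (k1 / 3 + k2 / 2) * ux y ^ 3) x * \<phi> t x
             + circle_conv green
                 (\<lambda>y. (2 * k1 / 3 + k2) * peakon a c t y ^ 3 + (k1 + 3 * k2 / 2) * peakon a c t y * ux y ^ 2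
                      + k3 * peakon a c t y ^ 2 + k3 / 2 * ux y ^ 2) x * \<phi>x))
      = integral {0..1} (\<lambda>z. p z * (D 1 0 t (z + c * t) + c * D 0 1 t (z + c * t)))"
    if t: "t \<in> {0<..<T}" for t
  proof -
    have t0: "t \<in> {0..<T}" using t by simp
    have \<phi>x: "deriv (\<phi> t) x = D 0 1 t x" for x by (rule DERIV_imp_deriv[OF dx[OF t0]])
    have dt': "((\<lambda>s. \<phi> s x) has_real_derivative D 1 0 t x) (at t)" for x
    proof -
      have "t \<in> interior {0..<T}" using t by (simp add: interior_atLeastLessThan)
      then have "at t within {0..<T} = at t" by (rule at_within_interior)
      then show ?thesis using dt[OF t0, of x] by metis
    qed
    have \<phi>t: "deriv (\<lambda>s. \<phi> s x) t = D 1 0 t x" for x by (rule DERIV_imp_deriv[OF dt'])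
    have perE: "period_one (\<lambda>x. D 1 0 t x + c * D 0 1 t x)"
      unfolding period_one_def
    proof
      fix x
      have "D 0 1 t (x + 1) = D 0 1 t x"
        using period_one_derivative[OF per[OF t0] dx[OF t0]] by (simp add: period_one_def)
      moreover have "D 1 0 t (x + 1) = D 1 0 t x"
      proof -
        have "((\<lambda>s. \<phi> s x) has_real_derivative D 1 0 t (x + 1)) (at t)"
        proof (rule has_field_derivative_transform_within_open[OF dt'[of "x + 1"], of "{0<..<T}"])
          show "\<phi> s (x + 1) = \<phi> s x" if "s \<in> {0<..<T}" for s
            using per[of s] that by (simp add: period_one_def)
        qed (use t in auto)
        then show ?thesis using dt'[of x] by (rule DERIV_unique)
      qed
      ultimately show "D 1 0 t (x + 1) + c * D 0 1 t (x + 1) = D 1 0 t x + c * D 0 1 t x" by simp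
    qed
    have "continuous_on UNIV (\<lambda>x. D 1 0 t x + c * D 0 1 t x)"
      by (rule continuous_on_add[OF cD[OF t0] continuous_on_mult[OF continuous_on_const cD[OF t0]]])
    from circle_integral_wave_mult[OF continuous this perE, of "c * t"]
    have "(LINT x|circle. p (frac (x - c * t)) * (D 1 0 t x + c * D 0 1 t x))
        = integral {0..1} (\<lambda>z. p z * (D 1 0 t (z + c * t) + c * D 0 1 t (z + c * t)))" .
    then show ?thesis
      unfolding Let_def \<phi>x \<phi>t
        peakon_weak_form_slice[OF assms(2) per[OF t0] dx[OF t0] cD[OF t0] cD[OF t0] refl]
      by (simp add: peakon)
  qed
  have init: "(LINT x|circle. peakon a c 0 x * \<phi> 0 x) = integral {0..1} (\<lambda>z. p z * \<phi> 0 z)"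
  proof -
    have "continuous_on UNIV (\<phi> 0)"
      using dx[of 0] T by (intro continuous_at_imp_continuous_on ballI DERIV_isCont) auto
    from circle_integral_wave_mult[OF continuous this per, of 0] T show ?thesis
      by (simp add: peakon)
  qed
  have "(LINT t|lebesgue_on {0..<T}. LINT x|circle.
         (let ux = weak_deriv (peakon a c t);
              \<phi>t = deriv (\<lambda>s. \<phi> s x) t;
              \<phi>x = deriv (\<phi> t) x
          in peakon a c t x * \<phi>t
             + (k1 + k2) / 3 * peakon a c t x ^ 3 * \<phi>x
             + k1 / 3 * ux x ^ 3 * \<phi> t x
             + k3 / 2 * peakon a c t x ^ 2 * \<phi>x
             - circle_conv green (\<lambda>y. (k1 / 3 + k2 / 2) * ux y ^ 3) x * \<phi> t x
             + circle_conv green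
                 (\<lambda>y. (2 * k1 / 3 + k2) * peakon a c t y ^ 3 + (k1 + 3 * k2 / 2) * peakon a c t y * ux y ^ 2
                      + k3 * peakon a c t y ^ 2 + k3 / 2 * ux y ^ 2) x * \<phi>x))
      = (LINT t|lebesgue_on {0..<T}. integral {0..1} (\<lambda>z. p z * (D 1 0 t (z + c * t) + c * D 0 1 t (z + c * t))))"
    (is "?L = ?R")
    \<comment> \<open>At \<open>t = 0\<close> the two-sided time derivative is unspecified; a single time is negligible.\<close>
  proof (rule integral_discrete_difference[where X = "{0}"])
    show "emeasure (lebesgue_on {0..<T}) {t} = 0" if "t \<in> {0}" for t
      using that T by (subst emeasure_restrict_space) auto
    show "{t} \<in> sets (lebesgue_on {0..<T})" if "t \<in> {0}" for t
      using that T by (auto simp: sets_restrict_space_iff)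
  qed (use slice in auto)
  also have "?R = - integral {0..1} (\<lambda>z. p z * \<phi> 0 z)"
    by (rule transport_integral[OF continuous T dt dx Dc Dc T'])
  finally show "?L + (LINT x|circle. peakon a c 0 x * \<phi> 0 x) = 0"
    using init by simp
qed

end
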